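(* Let $d\ge 1$, $x=(x_1,\dots,x_{d+1})\in\mathbf{R}^{d+1}$, $y=(y_1,\dots,y_{d+1})\in\mathbf{R}^{d+1}$ and $r>0$, and let $\tilde Z(x,y,r)=\int_{S^d(r)}\exp\left(\sum_{i=1}^{d+1}(x_it_i^2+y_it_i)\right)|dt|$. Then the following hold. 1. (Kume and Walker) The function $\tilde Z$ has the series expansion $$\tilde Z(x,y,r)=S_d\cdot\sum_{\alpha,\beta\in\mathbf{N}_0^{d+1}} r^{d+2|\alpha+\beta|}\,\frac{(d-1)!!\prod_{i=1}^{d+1}(2\alpha_i+2\beta_i-1)!!}{(d-1+2|\alpha|+2|\beta|)!!\,\alpha!\,(2\beta)!}\,x^\alpha y^{2\beta}.$$ 2. The truncation error of the series is estimated as $$\left|S_d\cdot\sum_{|\alpha+\beta|\ge N} r^{d+2|\alpha+\beta|}\,\frac{(d-1)!!\prod_{i=1}^{d+1}(2\alpha_i+2\beta_i-1)!!}{(d-1+2|\alpha|+2|\beta|)!!\,\alpha!\,(2\beta)!}\,x^\alpha y^{2\beta}\right|\le S_d\cdot\frac{r^d}{N!}\left(r^2\sum_{i=1}^{d+1}(|x_i|+|y_i|^2)\right)^N\frac{N+1}{N+1-r^2\sum_{i=1}^{d+1}(|x_i|+|y_i|^2)}$$ when $N$ is sufficiently large, where the sum on the left runs over all pairs $\alpha,\beta\in\mathbf{N}_0^{d+1}$ with $|\alpha+\beta|\ge N$.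
   Context: $\mathbf{N}_0=\{0,1,2,\dots\}$. $S^d(r)=\{t\in\mathbf{R}^{d+1}:\sum_{i=1}^{d+1}t_i^2=r^2\}$ is the $d$-dimensional sphere of radius $r$, and $|dt|$ is the standard measure on it, of total mass $r^d\,\frac{2\pi^{(d+1)/2}}{\Gamma((d+1)/2)}$. $S_d=\int_{S^d(1)}|dt|$ is the surface area of the $d$-sphere of radius $1$. For a multi-index $\alpha\in\mathbf{N}_0^{d+1}$: $|\alpha|=\sum_i\alpha_i$, $\alpha!=\prod_i\alpha_i!$, $x^\alpha=\prod_i x_i^{\alpha_i}$; $2\beta=(2\beta_1,\dots,2\beta_{d+1})$, so $(2\beta)!=\prod_i(2\beta_i)!$ and $y^{2\beta}=\prod_i y_i^{2\beta_i}$. $n!!$ is the double factorial, with $(-1)!!=0!!=1$. The function $\tilde Z$ is the normalizing constant of the Fisher–Bingham distribution on $S^d(r)$ restricted to diagonal quadratic parameter. *)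

theory Defs
  imports "HOL-Analysis.Analysis"
begin

fun double_fact :: "nat \<Rightarrow> nat" where
  "double_fact 0 = 1"
| "double_fact (Suc 0) = 1"
| "double_fact (Suc (Suc n)) = Suc (Suc n) * double_fact n"

text \<open>
  The standard surface measure on the sphere of radius \<open>r > 0\<close> in \<open>\<real>\<^sup>n\<close>, as a cone measure:
  the mass of a Borel set \<open>A\<close> is \<open>n / r\<close> times the Lebesgue volume of the punctured cone
  \<open>{s *\<^sub>R a | s a. 0 < s \<and> s \<le> 1 \<and> a \<in> A}\<close>, which is the preimage of \<open>A\<close> under radial projection
  of the punctured ball to the sphere. The lemmas \<open>emeasure_sphere_measure\<close> and
  \<open>distr_sphere_measure\<close> below confirm the total mass and the invariance under orthogonal maps
  (the latter over a well-ordered index type, as in the library's change-of-variables theorems).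
\<close>

definition sphere_measure :: "real \<Rightarrow> (real ^ 'n) measure" where
  "sphere_measure r = scale_measure (ennreal (real CARD('n) / r))
     (distr (restrict_space lborel (cball 0 r - {0})) (restrict_space borel (sphere 0 r))
        (\<lambda>t. (r / norm t) *\<^sub>R t))"

definition sphere_area :: "'n::finite itself \<Rightarrow> real" where
  "sphere_area _ = (\<integral>t. 1 \<partial>(sphere_measure 1 :: (real ^ 'n) measure))"

definition Z_tilde :: "real ^ 'n \<Rightarrow> real ^ 'n \<Rightarrow> real \<Rightarrow> real" where
  "Z_tilde x y r =
     (\<integral>t. exp (\<Sum>i\<in>UNIV. x $ i * (t $ i)\<^sup>2 + y $ i * t $ i) \<partial>sphere_measure r)"

definition mi_abs :: "nat ^ 'n \<Rightarrow> nat" where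
  "mi_abs \<alpha> = (\<Sum>i\<in>UNIV. \<alpha> $ i)"

definition mi_fact :: "nat ^ 'n \<Rightarrow> nat" where
  "mi_fact \<alpha> = (\<Prod>i\<in>UNIV. fact (\<alpha> $ i))"

definition mi_power :: "real ^ 'n \<Rightarrow> nat ^ 'n \<Rightarrow> real" where
  "mi_power x \<alpha> = (\<Prod>i\<in>UNIV. x $ i ^ \<alpha> $ i)"

text \<open>
  For \<open>\<alpha> $ i = \<beta> $ i = 0\<close> the truncated subtraction below turns the argument \<open>-1\<close> into \<open>0\<close>,
  which is harmless since \<open>(-1)!! = 0!! = 1\<close>.
\<close>

definition Z_term :: "nat \<Rightarrow> real ^ 'n \<Rightarrow> real ^ 'n \<Rightarrow> real \<Rightarrow> nat ^ 'n \<Rightarrow> nat ^ 'n \<Rightarrow> real" where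
  "Z_term d x y r \<alpha> \<beta> =
     r ^ (d + 2 * mi_abs (\<alpha> + \<beta>)) *
     (real (double_fact (d - 1) * (\<Prod>i\<in>UNIV. double_fact (2 * \<alpha> $ i + 2 * \<beta> $ i - 1))) /
      real (double_fact (d - 1 + 2 * mi_abs \<alpha> + 2 * mi_abs \<beta>) * mi_fact \<alpha> * mi_fact (2 *s \<beta>))) *
     mi_power x \<alpha> * mi_power y (2 *s \<beta>)"

lemma radial_projection_measurable:
  assumes "r > 0"
  shows "(\<lambda>t :: real ^ 'n. (r / norm t) *\<^sub>R t)
    \<in> restrict_space lborel (cball 0 r - {0}) \<rightarrow>\<^sub>M restrict_space borel (sphere 0 r)"
proof (rule measurable_restrict_space2)
  show "(\<lambda>t :: real ^ 'n. (r / norm t) *\<^sub>R t)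
      \<in> space (restrict_space lborel (cball 0 r - {0})) \<rightarrow> sphere 0 r"
    using assms by (auto simp: space_restrict_space)
  show "(\<lambda>t :: real ^ 'n. (r / norm t) *\<^sub>R t)
      \<in> restrict_space lborel (cball 0 r - {0}) \<rightarrow>\<^sub>M borel"
    by (rule measurable_restrict_space1) measurable
qed

lemma space_sphere_measure [simp]: "space (sphere_measure r :: (real ^ 'n) measure) = sphere 0 r"
  by (simp add: sphere_measure_def space_scale_measure space_restrict_space)

lemma sets_sphere_measure [simp, measurable_cong]:
  "sets (sphere_measure r :: (real ^ 'n) measure) = sets (restrict_space borel (sphere 0 r))"
  by (simp add: sphere_measure_def)

lemma emeasure_sphere_measure_eq:
  fixes A :: "(real ^ 'n) set"
  assumes "r > 0" and A: "A \<in> sets (restrict_space borel (sphere 0 r))"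
  shows "emeasure (sphere_measure r) A = ennreal (real CARD('n) / r) *
    emeasure lborel {t. t \<noteq> 0 \<and> norm t \<le> r \<and> (r / norm t) *\<^sub>R t \<in> A}"
proof -
  have "(\<lambda>t :: real ^ 'n. (r / norm t) *\<^sub>R t) -` A \<inter> (cball 0 r - {0}) =
      {t. t \<noteq> 0 \<and> norm t \<le> r \<and> (r / norm t) *\<^sub>R t \<in> A}"
    by auto
  moreover have "emeasure (restrict_space lborel (cball 0 r - {0}))
      {t. t \<noteq> 0 \<and> norm t \<le> r \<and> (r / norm t) *\<^sub>R t \<in> A} =
      emeasure lborel {t. t \<noteq> 0 \<and> norm t \<le> r \<and> (r / norm t) *\<^sub>R t \<in> A}"
    by (rule emeasure_restrict_space) auto
  ultimately show ?thesis
    by (simp add: sphere_measure_def emeasure_distr[OF radial_projection_measurable[OF assms(1)] A]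
        space_restrict_space)
qed

lemma emeasure_sphere_measure:
  assumes "r > 0"
  shows "emeasure (sphere_measure r :: (real ^ 'n) measure) (sphere 0 r) =
    ennreal (r ^ (CARD('n) - 1) *
      (2 * pi powr (real CARD('n) / 2) / Gamma (real CARD('n) / 2)))"
proof -
  let ?n = "CARD('n)"
  have "sphere 0 r \<in> sets (restrict_space borel (sphere (0 :: real ^ 'n) r))"
    by (subst sets_restrict_space_iff) auto
  then have "emeasure (sphere_measure r :: (real ^ 'n) measure) (sphere 0 r) =
      ennreal (real ?n / r) *
      emeasure lborel {t :: real ^ 'n. t \<noteq> 0 \<and> norm t \<le> r \<and> (r / norm t) *\<^sub>R t \<in> sphere 0 r}"
    by (rule emeasure_sphere_measure_eq[OF assms])
  also have "{t :: real ^ 'n. t \<noteq> 0 \<and> norm t \<le> r \<and> (r / norm t) *\<^sub>R t \<in> sphere 0 r} =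
      cball 0 r - {0}"
    using assms by auto
  also have "emeasure lborel (cball (0 :: real ^ 'n) r - {0}) = emeasure lborel (cball (0 :: real ^ 'n) r)"
    by (rule emeasure_Diff_null_set) (auto simp: null_sets_def)
  also have "\<dots> = ennreal (unit_ball_vol (real ?n) * r ^ ?n)"
    using assms by (subst emeasure_cball) auto
  also have "ennreal (real ?n / r) * \<dots> = ennreal (real ?n / r * (unit_ball_vol (real ?n) * r ^ ?n))"
    using assms by (subst ennreal_mult) auto
  also have "real ?n / r * (unit_ball_vol (real ?n) * r ^ ?n) =
      r ^ (?n - 1) * (real ?n * unit_ball_vol (real ?n))"
    using assms by (cases ?n) auto
  also have "real ?n * unit_ball_vol (real ?n) =
      2 * pi powr (real ?n / 2) / Gamma (real ?n / 2)"
  proof -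
    have "Gamma (real ?n / 2 + 1) = real ?n / 2 * Gamma (real ?n / 2)"
    proof (rule Gamma_plus1)
      have "real ?n / 2 > 0" by simp
      then show "real ?n / 2 \<notin> \<int>\<^sub>\<le>\<^sub>0" using nonpos_Ints_nonpos by fastforce
    qed
    moreover have "Gamma (real ?n / 2) > 0" by (rule Gamma_real_pos) simp
    ultimately show ?thesis by (simp only: unit_ball_vol_def) (simp add: field_simps)
  qed
  finally show ?thesis .
qed

lemma distr_sphere_measure:
  fixes g :: "real ^ 'n::{finite,wellorder} \<Rightarrow> real ^ 'n::_"
  assumes r: "r > 0" and g: "orthogonal_transformation g"
  shows "distr (sphere_measure r) (sphere_measure r) g = sphere_measure r"
proof (rule measure_eqI)
  have norm_g: "norm (g t) = norm t" for t
    using g by (rule orthogonal_transformation_norm)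
  have lin: "linear g" using g by (rule orthogonal_transformation_linear)
  have bij: "bij g" using g by (rule orthogonal_transformation_bij)
  have borel_g: "g \<in> borel_measurable borel"
    using lin by (intro borel_measurable_continuous_onI linear_continuous_on) (simp add: linear_conv_bounded_linear)
  have meas_g: "g \<in> sphere_measure r \<rightarrow>\<^sub>M sphere_measure r"
  proof -
    have "g \<in> restrict_space borel (sphere 0 r) \<rightarrow>\<^sub>M restrict_space borel (sphere 0 r)"
      by (rule measurable_restrict_space3[OF borel_g]) (auto simp: norm_g)
    then show ?thesis
      by (subst measurable_cong_sets[OF sets_sphere_measure sets_sphere_measure])
  qed
  fix A assume "A \<in> sets (distr (sphere_measure r) (sphere_measure r) g)"
  then have A: "A \<in> sets (restrict_space borel (sphere (0 :: real ^ 'n::_) r))" by simp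
  let ?C = "\<lambda>B. {t :: real ^ 'n::_. t \<noteq> 0 \<and> norm t \<le> r \<and> (r / norm t) *\<^sub>R t \<in> B}"
  have C_borel: "?C B \<in> sets borel" if "B \<in> sets (restrict_space borel (sphere (0 :: real ^ 'n::_) r))" for B
  proof -
    have "?C B = (cball 0 r - {0}) \<inter> (\<lambda>t. (r / norm t) *\<^sub>R t) -` B"
      by auto
    moreover have "B \<in> sets borel"
      using that by (subst (asm) sets_restrict_space_iff) auto
    moreover from this have "(\<lambda>t :: real ^ 'n::_. (r / norm t) *\<^sub>R t) -` B \<inter> space borel \<in> sets borel"
      by (intro measurable_sets[where A = borel]) auto
    ultimately show ?thesis by auto
  qed
  have gA: "g -` A \<inter> sphere 0 r \<in> sets (restrict_space borel (sphere 0 r))"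
    using measurable_sets[OF meas_g, of A] A by simp
  have "emeasure (distr (sphere_measure r) (sphere_measure r) g) A =
      emeasure (sphere_measure r) (g -` A \<inter> sphere 0 r)"
    using A by (subst emeasure_distr[OF meas_g]) auto
  also have "\<dots> = ennreal (real CARD('n) / r) * emeasure lborel (?C (g -` A \<inter> sphere 0 r))"
    by (rule emeasure_sphere_measure_eq[OF r gA])
  also have "emeasure lborel (?C (g -` A \<inter> sphere 0 r)) = emeasure lborel (?C A)"
  proof -
    let ?D = "?C (g -` A \<inter> sphere 0 r)"
    have g0: "g t = 0 \<longleftrightarrow> t = 0" for t using norm_g[of t] by (metis norm_eq_zero)
    have D_eq: "t \<in> ?D \<longleftrightarrow> g t \<in> ?C A" for t
    proof (cases "t = 0")
      case False
      then have "(r / norm t) *\<^sub>R t \<in> sphere 0 r" using r by simp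
      moreover have "g ((r / norm t) *\<^sub>R t) = (r / norm (g t)) *\<^sub>R g t"
        by (simp only: norm_g linear_scale[OF lin])
      ultimately show ?thesis
        unfolding mem_Collect_eq Int_iff vimage_eq g0 norm_g by (simp only: simp_thms)
    qed (simp add: g0)
    have img: "g ` ?D = ?C A"
    proof (intro subset_antisym subsetI)
      fix u assume "u \<in> g ` ?D"
      then obtain t where "u = g t" "t \<in> ?D" by (rule imageE)
      then show "u \<in> ?C A" by (simp only: D_eq)
    next
      fix u assume u: "u \<in> ?C A"
      have "surj g" using bij by (rule bij_is_surj)
      then obtain t where t: "u = g t" by (rule surjE)
      have "t \<in> ?D" using u unfolding t D_eq .
      then show "u \<in> g ` ?D" unfolding t by (rule imageI)
    qed
    have bnd: "?C B \<in> lmeasurable" if "B \<in> sets (restrict_space borel (sphere (0 :: real ^ 'n::_) r))" for B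
    proof (rule bounded_set_imp_lmeasurable)
      show "bounded (?C B)" by (rule bounded_subset[of "cball 0 r"]) auto
      show "?C B \<in> sets lebesgue" using C_borel[OF that] by simp
    qed
    have "measure lebesgue (?C A) = measure lebesgue ?D"
      using measure_orthogonal_image[OF g bnd[OF gA]] unfolding img .
    then have vol: "emeasure lebesgue (?C A) = emeasure lebesgue ?D"
      unfolding emeasure_eq_measure2[OF bnd[OF gA]] emeasure_eq_measure2[OF bnd[OF A]]
      by (rule arg_cong)
    have leb: "emeasure lebesgue (?C B) = emeasure lborel (?C B)"
      if "B \<in> sets (restrict_space borel (sphere (0 :: real ^ 'n::_) r))" for B
      using C_borel[OF that] by (simp del: mem_Collect_eq)
    show ?thesis using vol unfolding leb[OF A] leb[OF gA] by (rule sym)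
  qed
  finally show "emeasure (distr (sphere_measure r) (sphere_measure r) g) A = emeasure (sphere_measure r) A"
    using emeasure_sphere_measure_eq[OF r A] by simp
qed simp

end

theory Submission
  imports Defs "HOL-Probability.Distributions"
begin

text \<open>
  For a function \<open>F\<close> of the direction \<open>t / |t|\<close>, polar coordinates turn the integral of
  \<open>F(t / |t|) f(|t|)\<close> over \<open>\<real>\<^sup>n\<close> into the product of the integral of \<open>F\<close> over the unit sphere and
  \<open>\<integral> f(s) s\<^sup>n\<^sup>-\<^sup>1 ds\<close>. With \<open>f(s) = s\<^sup>k exp(-s\<^sup>2)\<close> and \<open>F\<close> a monomial of degree \<open>k\<close>, the left-hand side
  factors into one-dimensional Gaussian moments, which gives the moments of the sphere: they vanish
  if some exponent is odd and are ratios of double factorials otherwise. Expanding the exponential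
  into a series that converges uniformly on the sphere and integrating termwise yields the series.
  Its terms are bounded by \<open>r\<^sup>d a\<^sup>\<alpha> b\<^sup>\<beta> / (\<alpha>! \<beta>!)\<close> with \<open>a\<^sub>i = r\<^sup>2 |x\<^sub>i|\<close> and \<open>b\<^sub>i = r\<^sup>2 |y\<^sub>i|\<^sup>2\<close>, so by the
  multinomial theorem the tail is at most \<open>r\<^sup>d\<close> times the tail of an exponential series, which is
  compared with a geometric series.
\<close>

section \<open>Exponential series over multi-indices\<close>

text \<open>This is the binomial theorem divided by k!, a normalization that iterates without
  binomial coefficients.\<close>

lemma binomial_exponential_form:
  fixes u v :: real
  shows "(\<Sum>j\<le>k. u ^ j / fact j * (v ^ (k - j) / fact (k - j))) = (u + v) ^ k / fact k"
proof -
  have "u ^ j / fact j * (v ^ (k - j) / fact (k - j)) =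
      (of_nat (k choose j) * u ^ j * v ^ (k - j)) / fact k" if "j \<le> k" for j
    using binomial_fact[OF that, where 'a = real] by (simp add: field_simps)
  then show ?thesis
    by (simp add: binomial_ring sum_divide_distrib)
qed

lemma finite_multi_index_degree_eq:
  assumes "finite A"
  shows "finite {\<gamma> :: 'm \<Rightarrow> nat. (\<forall>i. i \<notin> A \<longrightarrow> \<gamma> i = 0) \<and> sum \<gamma> A = k}"
proof (rule finite_subset)
  show "{\<gamma>. (\<forall>i. i \<notin> A \<longrightarrow> \<gamma> i = 0) \<and> sum \<gamma> A = k} \<subseteq>
      {\<gamma>. \<forall>i. (i \<in> A \<longrightarrow> \<gamma> i \<in> {..k}) \<and> (i \<notin> A \<longrightarrow> \<gamma> i = 0)}"
    using member_le_sum[OF _ _ assms, of _ "_ :: 'm \<Rightarrow> nat"] by auto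
  show "finite {\<gamma> :: 'm \<Rightarrow> nat. \<forall>i. (i \<in> A \<longrightarrow> \<gamma> i \<in> {..k}) \<and> (i \<notin> A \<longrightarrow> \<gamma> i = 0)}"
    using assms by (rule finite_set_of_finite_funs) simp
qed

text \<open>Multi-indices on \<open>A\<close> are encoded as functions vanishing outside
  \<open>A\<close>, so that an induction on \<open>A\<close> stays within one type. A new element
  \<open>a\<close> contributes a factor in \<open>z a\<close>, and the binomial form merges it with
  the power already obtained.\<close>

lemma multinomial_exponential_form_on:
  fixes z :: "'m \<Rightarrow> real"
  assumes "finite A"
  shows "(\<Sum>\<gamma> | (\<forall>i. i \<notin> A \<longrightarrow> \<gamma> i = 0) \<and> sum \<gamma> A = k. \<Prod>i\<in>A. z i ^ \<gamma> i / fact (\<gamma> i)) =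
    (\<Sum>i\<in>A. z i) ^ k / fact k"
  using assms
proof (induction A arbitrary: k rule: finite_induct)
  case empty
  have "{\<gamma> :: 'm \<Rightarrow> nat. (\<forall>i. \<gamma> i = 0) \<and> 0 = k} = (if k = 0 then {\<lambda>_. 0} else {})"
    by auto
  then show ?case by simp
next
  case (insert a A)
  let ?S = "\<lambda>B k. {\<gamma> :: 'm \<Rightarrow> nat. (\<forall>i. i \<notin> B \<longrightarrow> \<gamma> i = 0) \<and> sum \<gamma> B = k}"
  let ?w = "\<lambda>\<gamma> i. z i ^ \<gamma> i / fact (\<gamma> i)"
  have sum_upd: "sum (\<gamma>(a := j)) A = sum \<gamma> A" for \<gamma> :: "'m \<Rightarrow> nat" and j
    using insert.hyps by (intro sum.cong) auto
  have prod_upd: "(\<Prod>i\<in>A. ?w (\<gamma>(a := j)) i) = (\<Prod>i\<in>A. ?w \<gamma> i)" for \<gamma> j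
    using insert.hyps by (intro prod.cong) auto
  \<comment> \<open>A multi-index is split into its entry j at \<open>a\<close> and the rest, with
    that entry reset to 0; the rest has degree k - j on \<open>A\<close>.\<close>
  have "(\<Sum>\<gamma>\<in>?S (insert a A) k. \<Prod>i\<in>insert a A. ?w \<gamma> i) =
      (\<Sum>(j, \<gamma>)\<in>Sigma {..k} (\<lambda>j. ?S A (k - j)). z a ^ j / fact j * (\<Prod>i\<in>A. ?w \<gamma> i))"
    using insert.hyps sum_upd prod_upd
    by (intro sum.reindex_bij_witness[where j = "\<lambda>\<gamma>. (\<gamma> a, \<gamma>(a := 0))" and i = "\<lambda>(j, \<gamma>). \<gamma>(a := j)"])
       (auto simp: fun_eq_iff)
  also have "\<dots> = (\<Sum>j\<le>k. z a ^ j / fact j * (\<Sum>\<gamma>\<in>?S A (k - j). \<Prod>i\<in>A. ?w \<gamma> i))"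
    using finite_multi_index_degree_eq[OF insert.hyps(1)]
    by (subst sum.Sigma[symmetric]) (auto simp: sum_distrib_left)
  also have "\<dots> = (z a + (\<Sum>i\<in>A. z i)) ^ k / fact k"
    unfolding insert.IH by (rule binomial_exponential_form)
  finally show ?case using insert.hyps by simp
qed

lemma finite_multi_index_degree:
  "finite {\<gamma> :: 'm::finite \<Rightarrow> nat. sum \<gamma> UNIV = k}"
  using finite_multi_index_degree_eq[of "UNIV :: 'm set" k] by simp

lemma multinomial_exponential_form:
  fixes z :: "'m::finite \<Rightarrow> real"
  shows "(\<Sum>\<gamma> | sum \<gamma> UNIV = k. \<Prod>i\<in>UNIV. z i ^ \<gamma> i / fact (\<gamma> i)) = (\<Sum>i\<in>UNIV. z i) ^ k / fact k"
  using multinomial_exponential_form_on[where A = "UNIV :: 'm set"] by simp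

lemma has_sum_exp_series:
  fixes u :: real
  shows "((\<lambda>k. u ^ k / fact k) has_sum exp u) UNIV"
proof (rule norm_summable_imp_has_sum)
  show "summable (\<lambda>k. norm (u ^ k / fact k))"
    using summable_norm_exp[of u] by (simp add: field_simps scaleR_conv_of_real)
  show "(\<lambda>k. u ^ k / fact k) sums exp u"
    using exp_converges[of u] by (simp add: field_simps scaleR_conv_of_real)
qed

text \<open>Multi-indices are grouped by total degree: each level is finite and sums to one term of
  the exponential series in one variable.\<close>

lemma has_sum_multi_index_exp:
  fixes z :: "'m::finite \<Rightarrow> real"
  shows "((\<lambda>\<gamma>. \<Prod>i\<in>UNIV. z i ^ \<gamma> i / fact (\<gamma> i)) has_sum exp (\<Sum>i\<in>UNIV. z i)) UNIV"
proof -
  let ?w = "\<lambda>z \<gamma>. \<Prod>i\<in>UNIV. (z :: 'm \<Rightarrow> real) i ^ \<gamma> i / fact (\<gamma> i)"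
  let ?B = "\<lambda>k. {\<gamma> :: 'm \<Rightarrow> nat. sum \<gamma> UNIV = k}"
  have level: "((\<lambda>\<gamma>. (?w z \<circ> snd) (k, \<gamma>)) has_sum (\<Sum>i\<in>UNIV. z i) ^ k / fact k) (?B k)" for z k
    using finite_multi_index_degree
    by (auto intro!: has_sum_finiteI simp: multinomial_exponential_form)
  \<comment> \<open>With absolute values all terms are nonnegative, so summability of the level sums
    suffices. Absolute summability then permits regrouping for arbitrary signs.\<close>
  have "(?w (\<lambda>i. \<bar>z i\<bar>) \<circ> snd) summable_on Sigma UNIV ?B"
    by (rule summable_on_SigmaI[OF level]) (auto intro!: prod_nonneg has_sum_imp_summable[OF has_sum_exp_series])
  then have "(\<lambda>p. norm ((?w z \<circ> snd) p)) summable_on Sigma UNIV ?B"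
    by (simp add: o_def abs_prod power_abs)
  then have summable: "(?w z \<circ> snd) summable_on Sigma UNIV ?B"
    by (rule abs_summable_summable)
  have "((?w z \<circ> snd) has_sum exp (\<Sum>i\<in>UNIV. z i)) (Sigma UNIV ?B)"
    by (rule has_sum_SigmaI[OF level has_sum_exp_series summable])
  moreover have "inj_on snd (Sigma UNIV ?B)" by (auto simp: inj_on_def)
  moreover have "snd ` Sigma UNIV ?B = UNIV" by force
  ultimately show ?thesis
    using has_sum_reindex[of snd "Sigma UNIV ?B" "?w z"] by simp
qed

text \<open>The finitely many multi-indices of degree below \<open>N\<close> are summed level by
  level and subtracted from the full sum.\<close>

lemma has_sum_multi_index_exp_tail:
  fixes z :: "'m::finite \<Rightarrow> real"
  shows "((\<lambda>\<gamma>. \<Prod>i\<in>UNIV. z i ^ \<gamma> i / fact (\<gamma> i)) has_sum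
    (exp (\<Sum>i\<in>UNIV. z i) - (\<Sum>k<N. (\<Sum>i\<in>UNIV. z i) ^ k / fact k))) {\<gamma>. N \<le> sum \<gamma> UNIV}"
proof -
  let ?w = "\<lambda>\<gamma>. \<Prod>i\<in>UNIV. z i ^ \<gamma> i / fact (\<gamma> i)"
  have eq: "{\<gamma> :: 'm \<Rightarrow> nat. sum \<gamma> UNIV < N} = (\<Union>k<N. {\<gamma>. sum \<gamma> UNIV = k})" by auto
  have fin: "finite {\<gamma> :: 'm \<Rightarrow> nat. sum \<gamma> UNIV < N}"
    unfolding eq using finite_multi_index_degree by blast
  have "(\<Sum>\<gamma> | sum \<gamma> UNIV < N. ?w \<gamma>) = (\<Sum>k<N. (\<Sum>i\<in>UNIV. z i) ^ k / fact k)"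
    unfolding eq multinomial_exponential_form[symmetric]
    by (rule sum.UNION_disjoint) (auto simp: finite_multi_index_degree)
  then have "(?w has_sum (\<Sum>k<N. (\<Sum>i\<in>UNIV. z i) ^ k / fact k)) {\<gamma>. sum \<gamma> UNIV < N}"
    using fin by (intro has_sum_finiteI) auto
  from has_sum_Diff[OF has_sum_multi_index_exp this]
  show ?thesis by (simp add: Diff_eq Collect_neg_eq[symmetric] not_less)
qed

text \<open>Each of the factors N+1, ..., N+k by which (N+k)! exceeds N! is at least N+1.\<close>

lemma fact_mult_power_le_fact:
  "fact N * (real N + 1) ^ k \<le> fact (N + k)"
proof (induction k)
  case (Suc k)
  have "fact N * (real N + 1) ^ Suc k = (fact N * (real N + 1) ^ k) * (real N + 1)" by simp
  also have "\<dots> \<le> fact (N + k) * (real (N + k) + 1)"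
    by (intro mult_mono Suc.IH) auto
  finally show ?case by (simp add: algebra_simps)
qed simp

text \<open>The tail is compared termwise with a geometric series of ratio u / (N+1), which is below
  1 by the second hypothesis.\<close>

lemma exp_tail_le:
  fixes u :: real
  assumes "0 \<le> u" and "u < real N + 1"
  shows "exp u - (\<Sum>k<N. u ^ k / fact k) \<le> u ^ N / fact N * ((real N + 1) / (real N + 1 - u))"
proof (rule sums_le)
  have "(\<lambda>k. u ^ k / fact k) sums exp u"
    using exp_converges[of u] by (simp add: field_simps scaleR_conv_of_real)
  then show "(\<lambda>k. u ^ (k + N) / fact (k + N)) sums (exp u - (\<Sum>k<N. u ^ k / fact k))"
    by (rule sums_split_initial_segment)
  have "(\<lambda>k. (u / (real N + 1)) ^ k) sums (1 / (1 - u / (real N + 1)))"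
    using assms by (intro geometric_sums) simp
  moreover have "1 / (1 - u / (real N + 1)) = (real N + 1) / (real N + 1 - u)"
    using assms by (simp add: field_simps)
  ultimately show "(\<lambda>k. u ^ N / fact N * (u / (real N + 1)) ^ k) sums
      (u ^ N / fact N * ((real N + 1) / (real N + 1 - u)))"
    by (intro sums_mult) simp
  show "u ^ (k + N) / fact (k + N) \<le> u ^ N / fact N * (u / (real N + 1)) ^ k" for k
  proof -
    have "u ^ (k + N) / fact (k + N) \<le> u ^ (k + N) / (fact N * (real N + 1) ^ k)"
      using fact_mult_power_le_fact[of N k] assms
      by (intro divide_left_mono) (auto simp: add.commute)
    then show ?thesis by (simp add: power_add power_divide mult.commute)
  qed
qed

section \<open>Double factorials\<close>

lemma double_fact_pos: "0 < double_fact k"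
  by (induction k rule: double_fact.induct) auto

text \<open>Raising \<open>b\<close> by one multiplies the left side by 2b+1 and the right side by
  the larger a+2b+2. At b = 0 the truncated 2b-1 is 0, and 0!! = 1.\<close>

lemma double_fact_mult_odd_le: "double_fact a * double_fact (2 * b - 1) \<le> double_fact (a + 2 * b)"
proof (induction b)
  case (Suc b)
  have "double_fact (2 * Suc b - 1) = (2 * b + 1) * double_fact (2 * b - 1)"
    by (cases b) auto
  then have "double_fact a * double_fact (2 * Suc b - 1) =
      (2 * b + 1) * (double_fact a * double_fact (2 * b - 1))"
    by (simp only: mult_ac)
  also have "\<dots> \<le> (a + 2 * b + 2) * double_fact (a + 2 * b)"
    by (intro mult_mono Suc.IH) auto
  finally show ?case by simp
qed simp

text \<open>Absorbing one odd double factorial at a time shows that the double factorial quotient in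
  a term of the series is at most 1.\<close>

lemma double_fact_prod_le:
  assumes "finite A"
  shows "double_fact a * (\<Prod>i\<in>A. double_fact (2 * g i - 1)) \<le> double_fact (a + 2 * sum g A)"
  using assms
proof (induction A rule: finite_induct)
  case (insert i A)
  have "double_fact a * (\<Prod>i\<in>insert i A. double_fact (2 * g i - 1)) =
      (double_fact a * (\<Prod>i\<in>A. double_fact (2 * g i - 1))) * double_fact (2 * g i - 1)"
    using insert.hyps by simp
  also have "\<dots> \<le> double_fact (a + 2 * sum g A) * double_fact (2 * g i - 1)"
    by (intro mult_right_mono insert.IH) simp
  also have "\<dots> \<le> double_fact (a + 2 * sum g A + 2 * g i)"
    by (rule double_fact_mult_odd_le)
  finally show ?case using insert.hyps by (simp add: algebra_simps)
qed simp

text \<open>This links (2k-1)!! to the quotient of factorials in which even Gaussian moments are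
  given.\<close>

lemma double_fact_eq_fact: "real (double_fact (2 * k - 1)) = fact (2 * k) / (2 ^ k * fact k)"
proof (induction k)
  case (Suc k)
  have "double_fact (2 * Suc k - 1) = (2 * k + 1) * double_fact (2 * k - 1)"
    by (cases k) auto
  then have "real (double_fact (2 * Suc k - 1)) = real (2 * k + 1) * real (double_fact (2 * k - 1))"
    by (metis of_nat_mult)
  also have "\<dots> = (2 * k + 1) * (fact (2 * k) / (2 ^ k * fact k))"
    by (simp only: Suc.IH)
  \<comment> \<open>Expanding the fraction by 2(k+1) completes the numerator to (2k+2)! and the
    denominator to 2^(k+1) (k+1)!.\<close>
  also have "\<dots> = (2 * (1 + real k)) * ((2 * k + 1) * fact (2 * k)) / ((2 * (1 + real k)) * (2 ^ k * fact k))"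
    by (subst mult_divide_mult_cancel_left) (auto simp: distrib_right)
  also have "\<dots> = fact (2 * Suc k) / (2 ^ Suc k * fact (Suc k))"
    by (simp add: algebra_simps)
  finally show ?case .
qed simp

section \<open>The sphere measure and polar coordinates\<close>

lemma measurable_cball [measurable]: "cball a r \<in> sets borel"
  by (rule borel_closed) simp

text \<open>It gives access to \<open>integral_density\<close> for Bochner integrals over
  \<open>sphere_measure\<close>.\<close>

lemma scale_measure_eq_density: "scale_measure c M = density M (\<lambda>_. c)"
  by (rule measure_eqI) (auto simp: emeasure_density_const)

text \<open>The half-lines form an intersection-stable generator of the Borel sets, and those with
  integer endpoints exhaust the line with finite mass.\<close>

lemma measure_eqI_atMost:
  fixes M N :: "real measure"
  assumes "sets M = sets borel" and "sets N = sets borel"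
    and "\<And>a. emeasure M {..a} = emeasure N {..a}" and "\<And>a. emeasure M {..a} \<noteq> \<infinity>"
  shows "M = N"
proof (rule measure_eqI_generator_eq[where E = "range atMost" and \<Omega> = UNIV and A = "\<lambda>i. {..real i}"])
  show "Int_stable (range atMost :: real set set)"
    by (auto simp: Int_stable_def)
  show "sets M = sigma_sets UNIV (range atMost)" "sets N = sigma_sets UNIV (range atMost)"
    by (simp_all add: assms(1,2) borel_eq_atMost)
  show "(\<Union>i. {..real i}) = UNIV"
    using real_arch_simple by auto
qed (use assms in auto)

lemma nn_integral_lborel_scaleR:
  fixes f :: "'a::euclidean_space \<Rightarrow> ennreal"
  assumes [measurable]: "f \<in> borel_measurable borel" and "0 < c"
  shows "(\<integral>\<^sup>+t. f t \<partial>lborel) = ennreal (c ^ DIM('a)) * (\<integral>\<^sup>+t. f (c *\<^sub>R t) \<partial>lborel)"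
  using assms(2)
  by (subst lborel_affine[of c 0])
     (auto simp: nn_integral_density nn_integral_distr nn_integral_cmult)

lemma integral_lborel_scaleR:
  fixes f :: "'a::euclidean_space \<Rightarrow> real"
  assumes [measurable]: "f \<in> borel_measurable borel" and "0 < c"
  shows "(\<integral>t. f t \<partial>lborel) = c ^ DIM('a) * (\<integral>t. f (c *\<^sub>R t) \<partial>lborel)"
  using assms(2)
  by (subst lborel_affine[of c 0])
     (auto simp: integral_density integral_distr)

section \<open>Integration over the sphere\<close>

lemma measurable_sphere_measure:
  assumes "f \<in> borel_measurable borel"
  shows "f \<in> borel_measurable (sphere_measure r :: (real ^ 'n) measure)"
  using assms by (simp add: measurable_cong_sets[OF sets_sphere_measure refl] measurable_restrict_space1)

lemma finite_measure_sphere_measure: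
  assumes "0 < r"
  shows "finite_measure (sphere_measure r :: (real ^ 'n) measure)"
  by (rule finite_measureI) (simp add: emeasure_sphere_measure[OF assms])

text \<open>The definition as a cone measure turns the integral into one over the ball, with the
  integrand extended constantly along rays. The removed origin is a null set.\<close>

lemma nn_integral_sphere_measure:
  fixes F :: "real ^ 'n \<Rightarrow> ennreal"
  assumes "0 < r" and F [measurable]: "F \<in> borel_measurable borel"
  shows "(\<integral>\<^sup>+t. F t \<partial>sphere_measure r) =
    ennreal (real CARD('n) / r) * (\<integral>\<^sup>+t. F ((r / norm t) *\<^sub>R t) * indicator (cball 0 r) t \<partial>lborel)"
proof -
  have "(\<integral>\<^sup>+t. F t \<partial>sphere_measure r) = ennreal (real CARD('n) / r) *
      (\<integral>\<^sup>+t. F ((r / norm t) *\<^sub>R t) * indicator (cball 0 r - {0}) t \<partial>lborel)"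
    unfolding sphere_measure_def
    by (subst nn_integral_scale_measure)
       (auto simp: nn_integral_distr[OF radial_projection_measurable[OF assms(1)]]
          nn_integral_restrict_space measurable_restrict_space1)
  also have "(\<integral>\<^sup>+t. F ((r / norm t) *\<^sub>R t) * indicator (cball 0 r - {0}) t \<partial>lborel) =
      (\<integral>\<^sup>+t. F ((r / norm t) *\<^sub>R t) * indicator (cball 0 r) t \<partial>lborel)"
    by (rule nn_integral_cong_AE)
      (use AE_lborel_singleton[of "0 :: real ^ 'n"] in eventually_elim, auto simp: indicator_def)
  finally show ?thesis .
qed

lemma integral_sphere_measure:
  fixes F :: "real ^ 'n \<Rightarrow> real"
  assumes "0 < r" and F [measurable]: "F \<in> borel_measurable borel"
  shows "(\<integral>t. F t \<partial>sphere_measure r) =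
    real CARD('n) / r * (\<integral>t. indicator (cball 0 r) t * F ((r / norm t) *\<^sub>R t) \<partial>lborel)"
proof -
  have "(\<integral>t. F t \<partial>sphere_measure r) =
      real CARD('n) / r * (\<integral>t. indicator (cball 0 r - {0}) t *\<^sub>R F ((r / norm t) *\<^sub>R t) \<partial>lborel)"
    unfolding sphere_measure_def scale_measure_eq_density using assms(1)
    by (subst integral_density)
       (auto simp: integral_distr[OF radial_projection_measurable[OF assms(1)]]
          integral_restrict_space measurable_restrict_space1)
  also have "(\<integral>t. indicator (cball 0 r - {0}) t *\<^sub>R F ((r / norm t) *\<^sub>R t) \<partial>lborel) =
      (\<integral>t. indicator (cball 0 r) t * F ((r / norm t) *\<^sub>R t) \<partial>lborel)"
  proof (rule integral_cong_AE)
    show "AE t in lborel. indicator (cball 0 r - {0}) t *\<^sub>R F ((r / norm t) *\<^sub>R t) =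
        indicator (cball 0 r) t * F ((r / norm t) *\<^sub>R t)"
      using AE_lborel_singleton[of "0 :: real ^ 'n"] by eventually_elim (auto simp: indicator_def)
  qed auto
  finally show ?thesis .
qed

text \<open>The dilation by \<open>r\<close> of the solid ball contributes r^n, and the prefactor n
  / r of the cone measure lowers the exponent to n - 1.\<close>

lemma integral_sphere_measure_scale:
  fixes F :: "real ^ 'n \<Rightarrow> real"
  assumes "0 < r" and F [measurable]: "F \<in> borel_measurable borel"
  shows "(\<integral>t. F t \<partial>sphere_measure r) = r ^ (CARD('n) - 1) * (\<integral>t. F (r *\<^sub>R t) \<partial>sphere_measure 1)"
proof -
  have "(\<integral>t. F t \<partial>sphere_measure r) =
      real CARD('n) / r * (\<integral>t. indicator (cball 0 r) t * F ((r / norm t) *\<^sub>R t) \<partial>lborel)"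
    by (rule integral_sphere_measure[OF assms])
  also have "(\<integral>t. indicator (cball 0 r) t * F ((r / norm t) *\<^sub>R t) \<partial>lborel) =
      r ^ CARD('n) * (\<integral>t. indicator (cball 0 r) (r *\<^sub>R t) *
        F ((r / norm (r *\<^sub>R t)) *\<^sub>R (r *\<^sub>R t)) \<partial>lborel)"
    using assms(1) by (subst integral_lborel_scaleR[of _ r]) auto
  also have "(\<lambda>t :: real ^ 'n. indicator (cball 0 r) (r *\<^sub>R t) * F ((r / norm (r *\<^sub>R t)) *\<^sub>R (r *\<^sub>R t))) =
      (\<lambda>t. indicator (cball 0 1) t * F (r *\<^sub>R ((1 / norm t) *\<^sub>R t)))"
    using assms(1) by (auto simp: fun_eq_iff indicator_def)
  also have "(\<integral>t. indicator (cball 0 1) t * F (r *\<^sub>R ((1 / norm t) *\<^sub>R t)) \<partial>lborel) =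
      (\<integral>t. F (r *\<^sub>R t) \<partial>sphere_measure 1) / real CARD('n)"
    by (subst integral_sphere_measure) auto
  also have "real CARD('n) / r * (r ^ CARD('n) * ((\<integral>t. F (r *\<^sub>R t) \<partial>sphere_measure 1) / real CARD('n))) =
      r ^ (CARD('n) - 1) * (\<integral>t. F (r *\<^sub>R t) \<partial>sphere_measure 1)"
    using assms(1) by (cases "CARD('n)") auto
  finally show ?thesis .
qed

text \<open>Since \<open>G\<close> is invariant under dilations, its mass in the ball of radius a is
  a^n times its mass in the unit ball. Differentiating in a gives the density of the norm.\<close>

lemma distr_norm_density_radial:
  fixes G :: "'a::euclidean_space \<Rightarrow> ennreal"
  assumes G [measurable]: "G \<in> borel_measurable borel"
    and homogeneous: "\<And>c t. 0 < c \<Longrightarrow> G (c *\<^sub>R t) = G t"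
    and finite: "(\<integral>\<^sup>+t. G t * indicator (cball 0 1) t \<partial>lborel) < \<infinity>"
  shows "distr (density lborel G) borel norm =
    density lborel (\<lambda>s. ennreal (real DIM('a) * s ^ (DIM('a) - 1)) * indicator {0..} s *
      (\<integral>\<^sup>+t. G t * indicator (cball 0 1) t \<partial>lborel))" (is "?L = ?R")
proof (rule measure_eqI_atMost)
  let ?n = "DIM('a)" and ?K = "\<integral>\<^sup>+t. G t * indicator (cball 0 1) t \<partial>lborel"
  have L: "emeasure ?L {..a} = ennreal (a ^ ?n) * indicator {0..} a * ?K" for a
  proof -
    have "emeasure ?L {..a} = (\<integral>\<^sup>+t. G t * indicator (cball 0 a) t \<partial>lborel)"
    proof -
      have "norm -` {..a} = cball (0 :: 'a) a" by auto
      then show ?thesis by (simp add: emeasure_distr emeasure_density)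
    qed
    also have "\<dots> = ennreal (a ^ ?n) * indicator {0..} a * ?K"
    proof (cases a "0 :: real" rule: linorder_cases)
      case greater
      have "(\<integral>\<^sup>+t. G t * indicator (cball 0 a) t \<partial>lborel) =
          ennreal (a ^ ?n) * (\<integral>\<^sup>+t. G (a *\<^sub>R t) * indicator (cball 0 a) (a *\<^sub>R t) \<partial>lborel)"
        using greater by (intro nn_integral_lborel_scaleR) auto
      also have "(\<lambda>t. G (a *\<^sub>R t) * indicator (cball 0 a) (a *\<^sub>R t)) = (\<lambda>t. G t * indicator (cball 0 1) t)"
        using greater by (auto simp: fun_eq_iff homogeneous split: split_indicator)
      finally show ?thesis using greater by simp
    next
      case equal
      \<comment> \<open>The ball of radius 0 is a single point, hence null, which matches 0^n = 0 in
        positive dimension.\<close>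
      have "AE t in lborel. G t * indicator (cball 0 a) t = 0"
        using AE_lborel_singleton[of "0 :: 'a"] by eventually_elim (auto simp: equal)
      then have "(\<integral>\<^sup>+t. G t * indicator (cball 0 a) t \<partial>lborel) = 0"
        by (subst nn_integral_0_iff_AE) auto
      then show ?thesis by (simp add: equal zero_power)
    qed simp
    finally show ?thesis .
  qed
  then show "emeasure ?L {..a} \<noteq> \<infinity>" for a
    using finite by (simp add: ennreal_mult_eq_top_iff split: split_indicator)
  have R: "emeasure ?R {..a} = ennreal (a ^ ?n) * indicator {0..} a * ?K" for a
  proof -
    have "emeasure ?R {..a} =
        (\<integral>\<^sup>+s. ennreal (real ?n * s ^ (?n - 1)) * indicator {0..a} s * ?K \<partial>lborel)"
      by (auto simp: emeasure_density intro!: nn_integral_cong split: split_indicator)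
    also have "\<dots> = (\<integral>\<^sup>+s. ennreal (real ?n * s ^ (?n - 1)) * indicator {0..a} s \<partial>lborel) * ?K"
      by (rule nn_integral_multc) auto
    also have "(\<integral>\<^sup>+s. ennreal (real ?n * s ^ (?n - 1)) * indicator {0..a} s \<partial>lborel) =
        ennreal (a ^ ?n) * indicator {0..} a"
    proof (cases "0 \<le> a")
      case True
      have "(\<integral>\<^sup>+s. ennreal (real ?n * s ^ (?n - 1)) * indicator {0..a} s \<partial>lborel) = ennreal (a ^ ?n - 0 ^ ?n)"
        using True by (intro nn_integral_FTC_Icc) (auto intro!: derivative_eq_intros)
      then show ?thesis using True by (simp add: zero_power)
    qed simp
    finally show ?thesis .
  qed
  show "emeasure ?L {..a} = emeasure ?R {..a}" for a
    unfolding L R ..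
qed auto

text \<open>The factor depending on the direction is taken as a density, and the weighted measure is
  pushed forward along the norm. Its mass in the unit ball, times n, is the integral of
  \<open>F\<close> over the unit sphere.\<close>

lemma nn_integral_polar:
  fixes F :: "real ^ 'n \<Rightarrow> ennreal" and f :: "real \<Rightarrow> ennreal"
  assumes F [measurable]: "F \<in> borel_measurable borel" and f [measurable]: "f \<in> borel_measurable borel"
    and finite: "(\<integral>\<^sup>+t. F t \<partial>sphere_measure 1) < \<infinity>"
  shows "(\<integral>\<^sup>+t. F ((1 / norm t) *\<^sub>R t) * f (norm t) \<partial>lborel) =
    (\<integral>\<^sup>+t. F t \<partial>sphere_measure 1) *
    (\<integral>\<^sup>+s. f s * ennreal (s ^ (CARD('n) - 1)) * indicator {0..} s \<partial>lborel)"
proof -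
  let ?G = "\<lambda>t. F ((1 / norm t) *\<^sub>R t)" and ?n = "CARD('n)"
  let ?K = "\<integral>\<^sup>+t. ?G t * indicator (cball 0 1) t \<partial>lborel"
  have sphere: "(\<integral>\<^sup>+t. F t \<partial>sphere_measure 1) = ennreal (real ?n) * ?K"
    by (subst nn_integral_sphere_measure) auto
  have K: "?K < \<infinity>"
    using finite unfolding sphere by (auto simp: ennreal_mult_less_top)
  have "(\<integral>\<^sup>+t. ?G t * f (norm t) \<partial>lborel) = (\<integral>\<^sup>+s. f s \<partial>distr (density lborel ?G) borel norm)"
    by (subst nn_integral_distr) (auto simp: nn_integral_density)
  also have "\<dots> = (\<integral>\<^sup>+s. (ennreal (real ?n * s ^ (?n - 1)) * indicator {0..} s * ?K) * f s \<partial>lborel)"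
    using K by (subst distr_norm_density_radial) (auto simp: nn_integral_density)
  also have "\<dots> = (\<integral>\<^sup>+s. (ennreal (real ?n) * ?K) * (f s * ennreal (s ^ (?n - 1)) * indicator {0..} s) \<partial>lborel)"
    by (intro nn_integral_cong) (auto simp: ennreal_mult mult_ac split: split_indicator)
  also have "\<dots> = (ennreal (real ?n) * ?K) * (\<integral>\<^sup>+s. f s * ennreal (s ^ (?n - 1)) * indicator {0..} s \<partial>lborel)"
    by (rule nn_integral_cmult) auto
  finally show ?thesis unfolding sphere .
qed

text \<open>Boundedness of \<open>F\<close> on a sphere of finite measure and integrability of the
  radial part make both factors finite, so the extended-real formula carries over to Bochner
  integrals.\<close>

lemma has_bochner_integral_polar_nonneg:
  fixes F :: "real ^ 'n \<Rightarrow> real" and f :: "real \<Rightarrow> real"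
  assumes F [measurable]: "F \<in> borel_measurable borel" and f [measurable]: "f \<in> borel_measurable borel"
    and F_bound: "\<And>t. norm t \<le> 1 \<Longrightarrow> 0 \<le> F t \<and> F t \<le> C"
    and f_nonneg: "\<And>s. 0 \<le> s \<Longrightarrow> 0 \<le> f s"
    and I: "has_bochner_integral lborel (\<lambda>s. indicator {0..} s * (f s * s ^ (CARD('n) - 1))) I"
  shows "has_bochner_integral lborel (\<lambda>t. F ((1 / norm t) *\<^sub>R t) * f (norm t))
    ((\<integral>t. F t \<partial>sphere_measure 1) * I)"
proof -
  interpret finite_measure "sphere_measure 1 :: (real ^ 'n) measure"
    by (rule finite_measure_sphere_measure) simp
  have "\<bar>F t\<bar> \<le> C" if "norm t \<le> 1" for t
    using F_bound[OF that] by simp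
  then have int: "integrable (sphere_measure 1) F"
    by (intro integrable_const_bound[of _ C]) (auto intro!: measurable_sphere_measure)
  have S: "(\<integral>\<^sup>+t. ennreal (F t) \<partial>sphere_measure 1) = ennreal (\<integral>t. F t \<partial>sphere_measure 1)"
    using int by (intro nn_integral_eq_integral AE_I2) (auto simp: F_bound)
  have S_nonneg: "0 \<le> (\<integral>t. F t \<partial>sphere_measure 1)"
    by (intro integral_nonneg_AE AE_I2) (auto simp: F_bound)
  have I_nonneg: "0 \<le> I"
    unfolding has_bochner_integral_integral_eq[OF I, symmetric]
    by (intro integral_nonneg_AE AE_I2) (auto simp: f_nonneg split: split_indicator)
  \<comment> \<open>Division by zero sends the origin to the vector 0, off the sphere; this is why
    the bound on \<open>F\<close> is assumed on the whole closed ball.\<close>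
  have unit: "norm ((1 / norm t) *\<^sub>R t) \<le> 1" for t :: "real ^ 'n" by simp
  have "(\<integral>\<^sup>+s. ennreal (f s) * ennreal (s ^ (CARD('n) - 1)) * indicator {0..} s \<partial>lborel) =
      (\<integral>\<^sup>+s. ennreal (indicator {0..} s * (f s * s ^ (CARD('n) - 1))) \<partial>lborel)"
    by (intro nn_integral_cong) (auto simp: ennreal_mult f_nonneg split: split_indicator)
  also have "\<dots> = ennreal I"
    unfolding has_bochner_integral_integral_eq[OF I, symmetric]
    using integrable.intros[OF I]
    by (intro nn_integral_eq_integral AE_I2) (auto simp: f_nonneg split: split_indicator)
  finally have I': "(\<integral>\<^sup>+s. ennreal (f s) * ennreal (s ^ (CARD('n) - 1)) * indicator {0..} s \<partial>lborel) = ennreal I" .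
  show ?thesis
  proof (rule has_bochner_integral_nn_integral)
    show "AE t in lborel. 0 \<le> F ((1 / norm t) *\<^sub>R t) * f (norm t)"
      by (intro AE_I2 mult_nonneg_nonneg conjunct1[OF F_bound[OF unit]] f_nonneg) simp
    have "(\<integral>\<^sup>+t. ennreal (F ((1 / norm t) *\<^sub>R t) * f (norm t)) \<partial>lborel) =
        (\<integral>\<^sup>+t. ennreal (F ((1 / norm t) *\<^sub>R t)) * ennreal (f (norm t)) \<partial>lborel)"
      by (intro nn_integral_cong ennreal_mult conjunct1[OF F_bound[OF unit]] f_nonneg) simp
    also have "\<dots> = (\<integral>\<^sup>+t. ennreal (F t) \<partial>sphere_measure 1) *
        (\<integral>\<^sup>+s. ennreal (f s) * ennreal (s ^ (CARD('n) - 1)) * indicator {0..} s \<partial>lborel)"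
      by (intro nn_integral_polar) (auto simp: S)
    also have "\<dots> = ennreal ((\<integral>t. F t \<partial>sphere_measure 1) * I)"
      unfolding I' S using S_nonneg I_nonneg by (simp add: ennreal_mult)
    finally show "(\<integral>\<^sup>+t. ennreal (F ((1 / norm t) *\<^sub>R t) * f (norm t)) \<partial>lborel) =
        ennreal ((\<integral>t. F t \<partial>sphere_measure 1) * I)" .
  qed (use S_nonneg I_nonneg in auto)
qed

lemma has_bochner_integral_polar:
  fixes F :: "real ^ 'n \<Rightarrow> real" and f :: "real \<Rightarrow> real"
  assumes F [measurable]: "F \<in> borel_measurable borel" and f [measurable]: "f \<in> borel_measurable borel"
    and F_bound: "\<And>t. norm t \<le> 1 \<Longrightarrow> \<bar>F t\<bar> \<le> 1"
    and f_nonneg: "\<And>s. 0 \<le> s \<Longrightarrow> 0 \<le> f s"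
    and I: "has_bochner_integral lborel (\<lambda>s. indicator {0..} s * (f s * s ^ (CARD('n) - 1))) I"
  shows "has_bochner_integral lborel (\<lambda>t. F ((1 / norm t) *\<^sub>R t) * f (norm t))
    ((\<integral>t. F t \<partial>sphere_measure 1) * I)"
proof -
  interpret finite_measure "sphere_measure 1 :: (real ^ 'n) measure"
    by (rule finite_measure_sphere_measure) simp
  have int: "integrable (sphere_measure 1) F"
    by (rule integrable_const_bound[of _ 1])
       (auto intro!: measurable_sphere_measure simp: F_bound)
  text \<open>The sign condition is arranged by shifting \<open>F\<close> by 1.\<close>
  have "has_bochner_integral lborel (\<lambda>t. (F ((1 / norm t) *\<^sub>R t) + 1) * f (norm t))
      ((\<integral>t. F t + 1 \<partial>sphere_measure 1) * I)"
    using F_bound by (intro has_bochner_integral_polar_nonneg[where C = 2] f_nonneg I)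
      (auto simp: abs_le_iff, force+)
  moreover have "has_bochner_integral lborel (\<lambda>t :: real ^ 'n. 1 * f (norm t))
      ((\<integral>t. 1 \<partial>(sphere_measure 1 :: (real ^ 'n) measure)) * I)"
    by (rule has_bochner_integral_polar_nonneg[of "\<lambda>_. 1" f 1 I]) (use f_nonneg I in auto)
  ultimately have "has_bochner_integral lborel
      (\<lambda>t. (F ((1 / norm t) *\<^sub>R t) + 1) * f (norm t) - 1 * f (norm t))
      ((\<integral>t. F t + 1 \<partial>sphere_measure 1) * I - (\<integral>t. 1 \<partial>(sphere_measure 1 :: (real ^ 'n) measure)) * I)"
    by (rule has_bochner_integral_diff)
  then show ?thesis
    using int by (simp add: algebra_simps)
qed

section \<open>Moments of the sphere\<close>

text \<open>Lebesgue measure on vectors is the image of a product measure indexed by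
  \<open>Basis\<close>, so the factors are moved from coordinates to basis vectors before Fubini
  applies.\<close>

lemma integral_lborel_prod:
  fixes g :: "'n::finite \<Rightarrow> real \<Rightarrow> real"
  assumes "\<And>i. integrable lborel (g i)"
  shows "(\<integral>t. (\<Prod>i\<in>UNIV. g i (t $ i)) \<partial>(lborel :: (real ^ 'n) measure)) = (\<Prod>i\<in>UNIV. \<integral>s. g i s \<partial>lborel)"
proof -
  have meas [measurable]: "g i \<in> borel_measurable borel" for i
    using assms[of i] by auto
  \<comment> \<open>\<open>THE\<close> inverts the injective map taking i to
    \<open>axis i 1\<close>.\<close>
  define h where "h b = g (THE i. b = (axis i 1 :: real ^ 'n))" for b
  have h: "h (axis i 1) = g i" for i
    by (simp add: h_def axis_eq_axis)
  have Basis: "(Basis :: (real ^ 'n) set) = (\<lambda>i. axis i 1) ` UNIV"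
    by (auto simp: Basis_vec_def)
  have inj: "inj (\<lambda>i. axis i 1 :: real ^ 'n)"
    by (auto simp: inj_on_def axis_eq_axis)
  have over_Basis: "(\<Prod>i\<in>UNIV. g i (t $ i)) = (\<Prod>b\<in>Basis. h b (t \<bullet> b))" for t :: "real ^ 'n"
    unfolding Basis by (simp add: prod.reindex[OF inj] h inner_axis)
  have int: "integrable lborel (h b)" if "b \<in> Basis" for b
    using that assms unfolding Basis by (auto simp: h)
  then have [measurable]: "h b \<in> borel_measurable borel" if "b \<in> Basis" for b
    using that by auto
  interpret product_sigma_finite "\<lambda>_ :: real ^ 'n. lborel :: real measure" ..
  have "(\<integral>t. (\<Prod>i\<in>UNIV. g i (t $ i)) \<partial>(lborel :: (real ^ 'n) measure)) =
      (\<integral>f. (\<Prod>b\<in>Basis. h b ((\<Sum>b\<in>Basis. f b *\<^sub>R b) \<bullet> b)) \<partial>Pi\<^sub>M (Basis :: (real ^ 'n) set) (\<lambda>_. lborel))"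
    unfolding over_Basis by (subst lborel_eq) (simp add: integral_distr)
  also have "\<dots> = (\<integral>f. (\<Prod>b\<in>Basis. h b (f b)) \<partial>Pi\<^sub>M (Basis :: (real ^ 'n) set) (\<lambda>_. lborel))"
    by (intro Bochner_Integration.integral_cong prod.cong) auto
  also have "\<dots> = (\<Prod>b\<in>Basis. \<integral>s. h b s \<partial>lborel)"
    by (rule product_integral_prod) (auto simp: int)
  also have "\<dots> = (\<Prod>i\<in>UNIV. \<integral>s. g i s \<partial>lborel)"
    unfolding Basis by (simp add: prod.reindex[OF inj] h)
  finally show ?thesis .
qed

text \<open>By parity the half-line moment is doubled for even \<open>m\<close> and cancels for odd
  \<open>m\<close>.\<close>

lemma has_bochner_integral_gaussian_moment:
  "has_bochner_integral lborel (\<lambda>s :: real. s ^ m * exp (- s\<^sup>2))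
    (if even m then sqrt pi * real (double_fact (m - 1)) / 2 ^ (m div 2) else 0)"
proof (cases "even m")
  case True
  then obtain k where m: "m = 2 * k" by blast
  have "has_bochner_integral lborel (\<lambda>s :: real. exp (- s\<^sup>2) * s ^ (2 * k))
      (2 *\<^sub>R ((sqrt pi / 2) * (fact (2 * k) / (2 ^ (2 * k) * fact k))))"
    by (rule has_bochner_integral_even_function[OF gaussian_moment_even_pos]) simp
  moreover have "2 *\<^sub>R ((sqrt pi / 2) * (fact (2 * k) / (2 ^ (2 * k) * fact k))) =
      sqrt pi * real (double_fact (m - 1)) / 2 ^ (m div 2)"
    unfolding m double_fact_eq_fact by (simp add: mult_2[of k] power_add)
  ultimately show ?thesis using True by (simp add: m mult.commute)
next
  case False
  then obtain k where m: "m = 2 * k + 1" using oddE by blast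
  have "has_bochner_integral lborel (\<lambda>s :: real. exp (- s\<^sup>2) * s ^ (2 * k + 1)) 0"
    by (rule has_bochner_integral_odd_function[OF gaussian_moment_odd_pos]) simp
  then show ?thesis using False by (simp add: m mult.commute)
qed

text \<open>This is the integral of s^m exp(-s^2) over the positive half-line, that is
  Gamma((m+1)/2) / 2, written with double factorials. At m = 0 the truncated m - 1 gives 0!! =
  1.\<close>

definition half_gaussian_moment :: "nat \<Rightarrow> real" where
  "half_gaussian_moment m =
     (if even m then sqrt pi / 2 else 1 / 2) * real (double_fact (m - 1)) / 2 ^ (m div 2)"

lemma double_fact_even: "double_fact (2 * k) = 2 ^ k * fact k"
  by (induction k) (auto simp: algebra_simps)

lemma has_bochner_integral_half_gaussian_moment:
  "has_bochner_integral lborel (\<lambda>s :: real. indicator {0..} s * (s ^ m * exp (- s\<^sup>2)))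
    (half_gaussian_moment m)"
proof (cases "even m")
  case True
  then obtain k where m: "m = 2 * k" by blast
  have "(sqrt pi / 2) * (fact (2 * k) / (2 ^ (2 * k) * fact k)) = half_gaussian_moment m"
    unfolding m half_gaussian_moment_def double_fact_eq_fact
    by (simp add: mult_2[of k] power_add)
  then show ?thesis
    using gaussian_moment_even_pos[of k] by (simp add: m mult.commute)
next
  case False
  then obtain k where m: "m = 2 * k + 1" using oddE by blast
  have "fact k / 2 = half_gaussian_moment m"
    unfolding m half_gaussian_moment_def by (simp add: double_fact_even)
  then show ?thesis
    using gaussian_moment_odd_pos[of k] by (simp add: m mult.commute)
qed

lemma half_gaussian_moment_pos: "0 < half_gaussian_moment m"
  using double_fact_pos[of "m - 1"] by (auto simp: half_gaussian_moment_def)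

text \<open>An even shift keeps the parity and hence the leading constant, so only double factorials
  and a power of 2 remain. With \<open>m\<close> positive, m + 2k - 1 and (m - 1) + 2k agree under
  truncated subtraction.\<close>

lemma half_gaussian_moment_add_even:
  assumes "1 \<le> m"
  shows "half_gaussian_moment (m + 2 * k) * (real (double_fact (m - 1)) * 2 ^ k) =
    half_gaussian_moment m * real (double_fact (m - 1 + 2 * k))"
proof -
  have "m + 2 * k - 1 = m - 1 + 2 * k" using assms by simp
  then show ?thesis
    by (simp add: half_gaussian_moment_def power_add)
qed

text \<open>The integral of the monomial times exp(-|t|^2) over the whole space is computed twice:
  polar coordinates give the left side, factorization over the coordinates the right side.\<close>

lemma monomial_sphere_moment_gaussian:
  "(\<integral>t. (\<Prod>i\<in>UNIV. (t $ i) ^ m i) \<partial>(sphere_measure 1 :: (real ^ 'n) measure)) *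
    half_gaussian_moment (CARD('n) - 1 + sum m UNIV) =
   (\<Prod>i\<in>UNIV. if even (m i) then sqrt pi * real (double_fact (m i - 1)) / 2 ^ (m i div 2) else 0)"
proof -
  let ?F = "\<lambda>t :: real ^ 'n. \<Prod>i\<in>UNIV. (t $ i) ^ m i"
  let ?f = "\<lambda>s. s ^ sum m UNIV * exp (- s\<^sup>2) :: real"
  have polar: "has_bochner_integral lborel (\<lambda>t. ?F ((1 / norm t) *\<^sub>R t) * ?f (norm t))
      ((\<integral>t. ?F t \<partial>sphere_measure 1) * half_gaussian_moment (CARD('n) - 1 + sum m UNIV))"
  proof (rule has_bochner_integral_polar)
    show "\<bar>?F t\<bar> \<le> 1" if "norm t \<le> 1" for t
    proof -
      have "\<bar>t $ i\<bar> \<le> 1" for i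
        using component_le_norm_cart[of t i] that by linarith
      then show ?thesis
        by (auto simp: abs_prod power_abs intro!: prod_le_1 power_le_one)
    qed
    show "has_bochner_integral lborel (\<lambda>s. indicator {0..} s * (?f s * s ^ (CARD('n) - 1)))
        (half_gaussian_moment (CARD('n) - 1 + sum m UNIV))"
      using has_bochner_integral_half_gaussian_moment[of "CARD('n) - 1 + sum m UNIV"]
      by (simp only: power_add mult_ac)
  qed auto
  \<comment> \<open>The power of the norm in \<open>?f\<close> undoes the normalization of the
    direction, and the Gaussian splits over the coordinates.\<close>
  have point: "?F ((1 / norm t) *\<^sub>R t) * ?f (norm t) = (\<Prod>i\<in>UNIV. (t $ i) ^ m i * exp (- (t $ i)\<^sup>2))"
    if "t \<noteq> 0" for t
  proof -
    have "(norm t)\<^sup>2 = (\<Sum>i\<in>UNIV. (t $ i)\<^sup>2)"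
      unfolding power2_norm_eq_inner by (simp add: inner_vec_def power2_eq_square)
    then have "exp (- (norm t)\<^sup>2) = (\<Prod>i\<in>UNIV. exp (- (t $ i)\<^sup>2))"
      by (simp add: exp_sum[symmetric] sum_negf)
    moreover have "?F ((1 / norm t) *\<^sub>R t) * norm t ^ sum m UNIV = ?F t"
      using that by (simp add: power_sum power_divide prod_dividef)
    ultimately show ?thesis
      by (simp add: prod.distrib mult.assoc[symmetric])
  qed
  have "(\<integral>t. ?F t \<partial>sphere_measure 1) * half_gaussian_moment (CARD('n) - 1 + sum m UNIV) =
      (\<integral>t. ?F ((1 / norm t) *\<^sub>R t) * ?f (norm t) \<partial>lborel)"
    using has_bochner_integral_integral_eq[OF polar] ..
  also have "\<dots> = (\<integral>t. (\<Prod>i\<in>UNIV. (t $ i) ^ m i * exp (- (t $ i)\<^sup>2)) \<partial>(lborel :: (real ^ 'n) measure))"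
  proof (rule integral_cong_AE)
    show "AE t in lborel. ?F ((1 / norm t) *\<^sub>R t) * ?f (norm t) =
        (\<Prod>i\<in>UNIV. (t $ i) ^ m i * exp (- (t $ i)\<^sup>2))"
      using AE_lborel_singleton[of "0 :: real ^ 'n"] by eventually_elim (rule point)
  qed auto
  also have "\<dots> = (\<Prod>i\<in>UNIV. \<integral>s. s ^ m i * exp (- s\<^sup>2) \<partial>lborel)"
    by (rule integral_lborel_prod) (rule integrable.intros[OF has_bochner_integral_gaussian_moment])
  finally show ?thesis
    by (simp add: has_bochner_integral_integral_eq[OF has_bochner_integral_gaussian_moment])
qed

lemma sphere_moment_odd:
  assumes "odd (m i)"
  shows "(\<integral>t. (\<Prod>i\<in>UNIV. (t $ i) ^ m i) \<partial>(sphere_measure 1 :: (real ^ 'n) measure)) = 0"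
proof -
  have "(\<integral>t. (\<Prod>i\<in>UNIV. (t $ i) ^ m i) \<partial>(sphere_measure 1 :: (real ^ 'n) measure)) *
      half_gaussian_moment (CARD('n) - 1 + sum m UNIV) = 0"
    unfolding monomial_sphere_moment_gaussian using assms by (intro prod_zero) auto
  then show ?thesis
    using half_gaussian_moment_pos[of "CARD('n) - 1 + sum m UNIV"] by simp
qed

text \<open>The Gaussian identity for the exponents 2 g is compared with the one for exponents 0,
  whose moment is the area. The power of sqrt pi cancels, and
  \<open>half_gaussian_moment_add_even\<close> turns the ratio of the radial moments into double
  factorials.\<close>

lemma sphere_moment_even:
  assumes "CARD('n) = d + 1" and "1 \<le> d"
  shows "(\<integral>t. (\<Prod>i\<in>UNIV. (t $ i) ^ (2 * g i)) \<partial>(sphere_measure 1 :: (real ^ 'n) measure)) =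
    sphere_area TYPE('n) * (real (double_fact (d - 1)) * (\<Prod>i\<in>UNIV. real (double_fact (2 * g i - 1))) /
      real (double_fact (d - 1 + 2 * sum g UNIV)))"
proof -
  let ?S = "\<integral>t. (\<Prod>i\<in>UNIV. (t $ i) ^ (2 * g i)) \<partial>(sphere_measure 1 :: (real ^ 'n) measure)"
  let ?G = "sum g UNIV" and ?R = half_gaussian_moment and ?P = "\<Prod>i\<in>UNIV. real (double_fact (2 * g i - 1))"
  have 1: "?S * ?R (d + 2 * ?G) * 2 ^ ?G = sqrt pi ^ (d + 1) * ?P"
    using monomial_sphere_moment_gaussian[of "\<lambda>i :: 'n. 2 * g i"] assms(1)
    by (simp add: sum_distrib_left[symmetric] prod.distrib prod_dividef power_sum)
  have 2: "sphere_area TYPE('n) * ?R d = sqrt pi ^ (d + 1)"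
    using monomial_sphere_moment_gaussian[of "\<lambda>i :: 'n. 0"] assms(1)
    by (simp add: sphere_area_def)
  let ?D = "real (double_fact (d - 1))" and ?E = "real (double_fact (d - 1 + 2 * ?G))"
  have "?R d * (?S * ?E) = (?S * ?R (d + 2 * ?G) * 2 ^ ?G) * ?D"
    using half_gaussian_moment_add_even[OF assms(2), of ?G] by (simp add: algebra_simps)
  also have "\<dots> = ?R d * (sphere_area TYPE('n) * (?D * ?P))"
    unfolding 1 2[symmetric] by (simp add: mult_ac)
  finally have "?S * ?E = sphere_area TYPE('n) * (?D * ?P)"
    using half_gaussian_moment_pos[of d] by simp
  then show ?thesis
    using double_fact_pos[of "d - 1 + 2 * ?G"] by (simp add: eq_divide_eq)
qed

section \<open>The series of the normalizing constant\<close>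

lemma integral_sphere_monomial:
  assumes "CARD('n) = d + 1" and "0 < r"
  shows "(\<integral>t. (\<Prod>i\<in>UNIV. (t $ i) ^ m i) \<partial>(sphere_measure r :: (real ^ 'n) measure)) =
    r ^ (d + sum m UNIV) * (\<integral>t. (\<Prod>i\<in>UNIV. (t $ i) ^ m i) \<partial>(sphere_measure 1 :: (real ^ 'n) measure))"
proof -
  have "(\<integral>t. (\<Prod>i\<in>UNIV. (t $ i) ^ m i) \<partial>(sphere_measure r :: (real ^ 'n) measure)) =
      r ^ d * (\<integral>t. (\<Prod>i\<in>UNIV. (r * t $ i) ^ m i) \<partial>(sphere_measure 1 :: (real ^ 'n) measure))"
    using assms by (subst integral_sphere_measure_scale) auto
  also have "(\<lambda>t :: real ^ 'n. \<Prod>i\<in>UNIV. (r * t $ i) ^ m i) =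
      (\<lambda>t. r ^ sum m UNIV * (\<Prod>i\<in>UNIV. (t $ i) ^ m i))"
    by (simp add: power_mult_distrib prod.distrib power_sum)
  finally show ?thesis by (simp add: power_add)
qed

text \<open>The M-test makes the finite partial sums converge uniformly, and on a finite measure
  space a uniform error integrates to a small error.\<close>

lemma has_sum_integral_Weierstrass:
  fixes f :: "'i \<Rightarrow> 'a \<Rightarrow> real"
  assumes "finite_measure M"
    and int: "\<And>i. integrable M (f i)" and int_S: "integrable M S"
    and bound: "\<And>i t. t \<in> space M \<Longrightarrow> \<bar>f i t\<bar> \<le> B i" and B: "B summable_on UNIV"
    and S: "\<And>t. t \<in> space M \<Longrightarrow> ((\<lambda>i. f i t) has_sum S t) UNIV"
  shows "((\<lambda>i. \<integral>t. f i t \<partial>M) has_sum (\<integral>t. S t \<partial>M)) UNIV"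
  unfolding has_sum_def
proof (rule tendstoI)
  interpret finite_measure M by fact
  fix e :: real assume "0 < e"
  \<comment> \<open>The added 1 keeps the denominator positive for a null measure and makes the
    final estimate strict.\<close>
  define e' where "e' = e / (measure M (space M) + 1)"
  have pos: "0 < measure M (space M) + 1"
    using measure_nonneg[of M "space M"] by linarith
  then have e': "0 < e'" using \<open>0 < e\<close> by (simp add: e'_def)
  have "uniform_limit (space M) (\<lambda>F t. \<Sum>i\<in>F. f i t) S (finite_subsets_at_top UNIV)"
    using bound S B by (intro Weierstrass_m_test_general'[where M = B]) auto
  then have "\<forall>\<^sub>F F in finite_subsets_at_top UNIV. \<forall>t\<in>space M. dist (\<Sum>i\<in>F. f i t) (S t) < e'"
    using e' by (rule uniform_limitD)
  then show "\<forall>\<^sub>F F in finite_subsets_at_top UNIV. dist (\<Sum>i\<in>F. \<integral>t. f i t \<partial>M) (\<integral>t. S t \<partial>M) < e"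
  proof eventually_elim
    case (elim F)
    have "dist (\<Sum>i\<in>F. \<integral>t. f i t \<partial>M) (\<integral>t. S t \<partial>M) = \<bar>\<integral>t. (\<Sum>i\<in>F. f i t) - S t \<partial>M\<bar>"
      using int int_S by (simp add: dist_real_def)
    also have "\<dots> \<le> (\<integral>t. \<bar>(\<Sum>i\<in>F. f i t) - S t\<bar> \<partial>M)"
      by (rule integral_abs_bound)
    also have "\<dots> \<le> (\<integral>t. e' \<partial>M)"
      using elim int int_S by (intro integral_mono) (auto simp: dist_real_def less_imp_le)
    also have "\<dots> = measure M (space M) * e'" by simp
    also have "\<dots> < e"
      using \<open>0 < e\<close> pos by (simp add: e'_def field_simps)
    finally show ?case .
  qed
qed

section \<open>Exponential weights of pairs of multi-indices\<close>

lemma sum_UNIV_Plus: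
  "sum f (UNIV :: ('a::finite + 'b::finite) set) = (\<Sum>i\<in>UNIV. f (Inl i)) + (\<Sum>i\<in>UNIV. f (Inr i))"
  unfolding UNIV_Plus_UNIV[symmetric] by (subst sum.Plus) auto

lemma prod_UNIV_Plus:
  "prod f (UNIV :: ('a::finite + 'b::finite) set) = (\<Prod>i\<in>UNIV. f (Inl i)) * (\<Prod>i\<in>UNIV. f (Inr i))"
  unfolding UNIV_Plus_UNIV[symmetric] by (subst prod.Plus) auto

definition exp_weight :: "real ^ 'n \<Rightarrow> nat ^ 'n \<Rightarrow> real" where
  "exp_weight z \<alpha> = (\<Prod>i\<in>UNIV. z $ i ^ \<alpha> $ i / fact (\<alpha> $ i))"

text \<open>Pairs of multi-indices over \<open>'n\<close> are treated as multi-indices over \<open>'n + 'n\<close>.\<close>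

lemma has_sum_exp_weight_tail:
  fixes a b :: "real ^ 'n"
  defines "A \<equiv> (\<Sum>i\<in>UNIV. a $ i + b $ i)"
  shows "((\<lambda>(\<alpha>, \<beta>). exp_weight a \<alpha> * exp_weight b \<beta>) has_sum (exp A - (\<Sum>k<N. A ^ k / fact k)))
    {(\<alpha>, \<beta>). N \<le> mi_abs (\<alpha> + \<beta>)}"
proof -
  let ?z = "case_sum (($) a) (($) b)"
  let ?join = "\<lambda>(\<alpha> :: nat ^ 'n, \<beta> :: nat ^ 'n). case_sum (($) \<alpha>) (($) \<beta>)"
  let ?split = "\<lambda>\<gamma>. (\<chi> i. \<gamma> (Inl i), \<chi> i. \<gamma> (Inr i)) :: (nat ^ 'n) \<times> (nat ^ 'n)"
  have A: "sum ?z UNIV = A"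
    by (simp add: sum_UNIV_Plus A_def sum.distrib)
  have "((\<lambda>(\<alpha>, \<beta>). exp_weight a \<alpha> * exp_weight b \<beta>) has_sum (exp A - (\<Sum>k<N. A ^ k / fact k)))
      {(\<alpha>, \<beta>). N \<le> mi_abs (\<alpha> + \<beta>)} \<longleftrightarrow>
    ((\<lambda>\<gamma>. \<Prod>i\<in>UNIV. ?z i ^ \<gamma> i / fact (\<gamma> i)) has_sum (exp A - (\<Sum>k<N. A ^ k / fact k)))
      {\<gamma>. N \<le> sum \<gamma> UNIV}"
    by (rule has_sum_reindex_bij_witness[where i = ?split and j = ?join])
       (auto simp: sum_UNIV_Plus prod_UNIV_Plus mi_abs_def exp_weight_def sum.distrib vec_eq_iff
         fun_eq_iff split: sum.split)
  then show ?thesis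
    using has_sum_multi_index_exp_tail[of ?z N] unfolding A by simp
qed

lemma has_sum_exp_weight:
  fixes a b :: "real ^ 'n"
  shows "((\<lambda>(\<alpha>, \<beta>). exp_weight a \<alpha> * exp_weight b \<beta>) has_sum exp (\<Sum>i\<in>UNIV. a $ i + b $ i)) UNIV"
  using has_sum_exp_weight_tail[of a b 0] by simp

lemma mi_power_div_mi_fact: "mi_power x \<alpha> / real (mi_fact \<alpha>) = exp_weight x \<alpha>"
  by (simp add: mi_power_def mi_fact_def exp_weight_def prod_dividef)

lemma mi_abs_add: "mi_abs (\<alpha> + \<beta>) = mi_abs \<alpha> + mi_abs \<beta>"
  by (simp add: mi_abs_def sum.distrib)

text \<open>Besides the identity of |y|^(2 \<beta>) and (|y|^2)^\<beta>, it uses (2 \<beta>)! \<ge>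
  \<beta>!; this is how |y_i|^2 enters the error bound alongside |x_i|.\<close>

lemma abs_exp_weight_even_le:
  "\<bar>exp_weight y (2 *s \<beta>)\<bar> \<le> exp_weight (\<chi> i. \<bar>y $ i\<bar>\<^sup>2) \<beta>"
  unfolding exp_weight_def abs_prod
proof (intro prod_mono conjI)
  fix i
  have "\<bar>y $ i ^ (2 *s \<beta>) $ i / fact ((2 *s \<beta>) $ i)\<bar> = (\<bar>y $ i\<bar>\<^sup>2) ^ \<beta> $ i / fact (2 * \<beta> $ i)"
    by (simp add: power_mult power_abs)
  also have "\<dots> \<le> (\<bar>y $ i\<bar>\<^sup>2) ^ \<beta> $ i / fact (\<beta> $ i)"
    by (intro divide_left_mono fact_mono) auto
  finally show "\<bar>y $ i ^ (2 *s \<beta>) $ i / fact ((2 *s \<beta>) $ i)\<bar> \<le>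
      (\<chi> i. \<bar>y $ i\<bar>\<^sup>2) $ i ^ \<beta> $ i / fact (\<beta> $ i)"
    by simp
qed simp

lemma abs_exp_weight: "\<bar>exp_weight x \<alpha>\<bar> = exp_weight (\<chi> i. \<bar>x $ i\<bar>) \<alpha>"
  by (simp add: exp_weight_def abs_prod power_abs)

lemma exp_weight_scale: "exp_weight (c *s x) \<alpha> = c ^ mi_abs \<alpha> * exp_weight x \<alpha>"
  by (simp add: exp_weight_def mi_abs_def power_mult_distrib prod.distrib power_sum[symmetric] prod_dividef)

section \<open>Bounds for the terms and the truncation error\<close>

lemma Z_term_eq:
  "Z_term d x y r \<alpha> \<beta> = r ^ (d + 2 * mi_abs (\<alpha> + \<beta>)) *
    (real (double_fact (d - 1)) * (\<Prod>i\<in>UNIV. real (double_fact (2 * (\<alpha> $ i + \<beta> $ i) - 1))) /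
      real (double_fact (d - 1 + 2 * mi_abs (\<alpha> + \<beta>)))) *
    (exp_weight x \<alpha> * exp_weight y (2 *s \<beta>))"
  unfolding Z_term_def mi_power_div_mi_fact[symmetric] mi_abs_add
  by (simp add: algebra_simps)

text \<open>The double factorial quotient \<open>?q\<close> is at most 1, and the factors r^2, one
  for each unit of degree, are absorbed into the weights.\<close>

lemma abs_Z_term_le:
  fixes x y :: "real ^ 'n"
  assumes "0 < r"
  shows "\<bar>Z_term d x y r \<alpha> \<beta>\<bar> \<le> r ^ d *
    (exp_weight (\<chi> i. r\<^sup>2 * \<bar>x $ i\<bar>) \<alpha> * exp_weight (\<chi> i. r\<^sup>2 * \<bar>y $ i\<bar>\<^sup>2) \<beta>)"
proof -
  let ?q = "real (double_fact (d - 1)) * (\<Prod>i\<in>UNIV. real (double_fact (2 * (\<alpha> $ i + \<beta> $ i) - 1))) /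
      real (double_fact (d - 1 + 2 * mi_abs (\<alpha> + \<beta>)))"
  have "double_fact (d - 1) * (\<Prod>i\<in>UNIV. double_fact (2 * (\<alpha> $ i + \<beta> $ i) - 1)) \<le>
      double_fact (d - 1 + 2 * mi_abs (\<alpha> + \<beta>))"
    using double_fact_prod_le[of UNIV "d - 1" "\<lambda>i. \<alpha> $ i + \<beta> $ i"] by (simp add: mi_abs_def)
  then have "real (double_fact (d - 1) * (\<Prod>i\<in>UNIV. double_fact (2 * (\<alpha> $ i + \<beta> $ i) - 1))) \<le>
      real (double_fact (d - 1 + 2 * mi_abs (\<alpha> + \<beta>)))"
    by (rule of_nat_mono)
  then have q: "?q \<le> 1"
    using double_fact_pos[of "d - 1 + 2 * mi_abs (\<alpha> + \<beta>)"] by (simp add: divide_le_eq)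
  have q_nonneg: "0 \<le> ?q"
    by (intro divide_nonneg_nonneg mult_nonneg_nonneg prod_nonneg) auto
  have "\<bar>Z_term d x y r \<alpha> \<beta>\<bar> =
      r ^ (d + 2 * mi_abs (\<alpha> + \<beta>)) * ?q * (\<bar>exp_weight x \<alpha>\<bar> * \<bar>exp_weight y (2 *s \<beta>)\<bar>)"
    using assms by (simp only: Z_term_eq abs_mult abs_of_nonneg[OF q_nonneg] power_abs abs_of_pos)
  also have "\<dots> \<le> r ^ (d + 2 * mi_abs (\<alpha> + \<beta>)) * 1 *
      (exp_weight (\<chi> i. \<bar>x $ i\<bar>) \<alpha> * exp_weight (\<chi> i. \<bar>y $ i\<bar>\<^sup>2) \<beta>)"
    using assms q q_nonneg abs_exp_weight_even_le[of y \<beta>]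
    by (intro mult_mono mult_nonneg_nonneg) (auto simp: abs_exp_weight[symmetric])
  also have "\<dots> = r ^ d * (exp_weight (r\<^sup>2 *s (\<chi> i. \<bar>x $ i\<bar>)) \<alpha> * exp_weight (r\<^sup>2 *s (\<chi> i. \<bar>y $ i\<bar>\<^sup>2)) \<beta>)"
    by (simp only: exp_weight_scale mi_abs_add power_add power_mult mult_ac mult_1)
  finally show ?thesis
    by (simp add: vector_scalar_mult_def)
qed

text \<open>The majorants sum over the tail to r^d times the tail of exp at \<open>A\<close>, which
  \<open>exp_tail_le\<close> estimates.\<close>

lemma Z_tail_le:
  fixes x y :: "real ^ 'n"
  assumes "0 < r"
  defines "A \<equiv> r\<^sup>2 * (\<Sum>i\<in>UNIV. \<bar>x $ i\<bar> + \<bar>y $ i\<bar>\<^sup>2)"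
  assumes N: "A < real N + 1"
  shows "\<bar>\<Sum>\<^sub>\<infinity>(\<alpha>, \<beta>)\<in>{(\<alpha>, \<beta>). mi_abs (\<alpha> + \<beta>) \<ge> N}. Z_term d x y r \<alpha> \<beta>\<bar> \<le>
    r ^ d * (A ^ N / fact N * ((real N + 1) / (real N + 1 - A)))"
proof -
  let ?T = "{(\<alpha>, \<beta>). mi_abs (\<alpha> + \<beta>) \<ge> N} :: ((nat ^ 'n) \<times> (nat ^ 'n)) set"
  let ?a = "\<chi> i. r\<^sup>2 * \<bar>x $ i\<bar>" and ?b = "\<chi> i. r\<^sup>2 * \<bar>y $ i\<bar>\<^sup>2"
  have A: "(\<Sum>i\<in>UNIV. ?a $ i + ?b $ i) = A"
    by (simp add: A_def sum_distrib_left distrib_left)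
  have A_nonneg: "0 \<le> A"
    unfolding A_def by (intro mult_nonneg_nonneg sum_nonneg) auto
  have maj: "((\<lambda>p. r ^ d * (case p of (\<alpha>, \<beta>) \<Rightarrow> exp_weight ?a \<alpha> * exp_weight ?b \<beta>)) has_sum
      (r ^ d * (exp A - (\<Sum>k<N. A ^ k / fact k)))) ?T"
    using has_sum_exp_weight_tail[of ?a ?b N] unfolding A by (rule has_sum_cmult_right)
  have le: "norm (case p of (\<alpha>, \<beta>) \<Rightarrow> Z_term d x y r \<alpha> \<beta>) \<le>
      r ^ d * (case p of (\<alpha>, \<beta>) \<Rightarrow> exp_weight ?a \<alpha> * exp_weight ?b \<beta>)" for p
    using abs_Z_term_le[OF assms(1), of d x y] by (cases p) simp
  \<comment> \<open>\<open>infsum\<close> defaults to 0 on families that are not summable, so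
    absolute summability is secured before comparing sums.\<close>
  have abs: "(\<lambda>p. norm (case p of (\<alpha>, \<beta>) \<Rightarrow> Z_term d x y r \<alpha> \<beta>)) summable_on ?T"
    by (rule Infinite_Sum.abs_summable_on_comparison_test'[OF has_sum_imp_summable[OF maj] le])
  have "\<bar>\<Sum>\<^sub>\<infinity>(\<alpha>, \<beta>)\<in>?T. Z_term d x y r \<alpha> \<beta>\<bar> \<le> (\<Sum>\<^sub>\<infinity>p\<in>?T. norm (case p of (\<alpha>, \<beta>) \<Rightarrow> Z_term d x y r \<alpha> \<beta>))"
    using norm_infsum_bound[OF abs] by simp
  also have "\<dots> \<le> r ^ d * (exp A - (\<Sum>k<N. A ^ k / fact k))"
    using has_sum_mono[OF has_sum_infsum[OF abs] maj le] .
  also have "\<dots> \<le> r ^ d * (A ^ N / fact N * ((real N + 1) / (real N + 1 - A)))"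
    using assms(1) exp_tail_le[OF A_nonneg N] by (intro mult_left_mono) auto
  finally show ?thesis .
qed

text \<open>The exponential is expanded over all exponents of \<open>y\<close>, odd ones included.
  On the sphere every coordinate is at most \<open>r\<close> in absolute value, which gives the
  summable majorant \<open>?B\<close> independent of t and permits integration term by term.\<close>

lemma has_sum_Z_tilde_all:
  fixes x y :: "real ^ 'n"
  assumes "0 < r"
  shows "((\<lambda>(\<alpha>, \<beta>). exp_weight x \<alpha> * exp_weight y \<beta> *
      (\<integral>t. (\<Prod>i\<in>UNIV. (t $ i) ^ (2 * \<alpha> $ i + \<beta> $ i)) \<partial>(sphere_measure r :: (real ^ 'n) measure)))
    has_sum Z_tilde x y r) UNIV"
proof -
  let ?M = "sphere_measure r :: (real ^ 'n) measure"
  let ?f = "\<lambda>(\<alpha> :: nat ^ 'n, \<beta>) t. exp_weight (\<chi> i. x $ i * (t $ i)\<^sup>2) \<alpha> * exp_weight (\<chi> i. y $ i * t $ i) \<beta>"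
  let ?B = "\<lambda>(\<alpha> :: nat ^ 'n, \<beta>). exp_weight (\<chi> i. \<bar>x $ i\<bar> * r\<^sup>2) \<alpha> * exp_weight (\<chi> i. \<bar>y $ i\<bar> * r) \<beta>"
  let ?S = "\<lambda>t. exp (\<Sum>i\<in>UNIV. x $ i * (t $ i)\<^sup>2 + y $ i * t $ i)"
  have monomial: "?f (\<alpha>, \<beta>) t = exp_weight x \<alpha> * exp_weight y \<beta> * (\<Prod>i\<in>UNIV. (t $ i) ^ (2 * \<alpha> $ i + \<beta> $ i))"
    for \<alpha> \<beta> t
    by (simp add: exp_weight_def power_mult_distrib power_add power_mult prod.distrib prod_dividef)
  have fin: "finite_measure ?M" by (rule finite_measure_sphere_measure[OF assms])
  interpret finite_measure ?M by (rule fin)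
  have comp: "\<bar>t $ i\<bar> \<le> r" if "t \<in> space ?M" for t i
    using that component_le_norm_cart[of t i] by simp
  have bound: "\<bar>?f p t\<bar> \<le> ?B p" if "t \<in> space ?M" for p t
  proof (cases p)
    case (Pair \<alpha> \<beta>)
    have "(t $ i)\<^sup>2 \<le> r\<^sup>2" for i
      using power_mono[OF comp[OF that, of i], of 2] by simp
    then have "\<bar>exp_weight (\<chi> i. x $ i * (t $ i)\<^sup>2) \<alpha>\<bar> \<le> exp_weight (\<chi> i. \<bar>x $ i\<bar> * r\<^sup>2) \<alpha>"
      unfolding abs_exp_weight unfolding exp_weight_def
      by (intro prod_mono conjI divide_right_mono divide_nonneg_nonneg power_mono)
         (auto simp: abs_mult intro!: mult_left_mono)
    moreover have "\<bar>exp_weight (\<chi> i. y $ i * t $ i) \<beta>\<bar> \<le> exp_weight (\<chi> i. \<bar>y $ i\<bar> * r) \<beta>"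
      unfolding abs_exp_weight unfolding exp_weight_def using comp[OF that]
      by (intro prod_mono conjI divide_right_mono divide_nonneg_nonneg power_mono)
         (auto simp: abs_mult intro!: mult_left_mono)
    ultimately show ?thesis
      unfolding Pair by (auto simp: abs_mult intro!: mult_mono intro: order.trans[OF abs_ge_zero])
  qed
  have int: "integrable ?M (?f p)" for p
  proof (rule integrable_const_bound)
    show "AE t in ?M. norm (?f p t) \<le> ?B p"
      by (rule AE_I2) (use bound in \<open>simp only: real_norm_def\<close>)
    show "?f p \<in> borel_measurable ?M"
    proof (cases p)
      case (Pair \<alpha> \<beta>)
      have "?f p = (\<lambda>t. exp_weight x \<alpha> * exp_weight y \<beta> * (\<Prod>i\<in>UNIV. (t $ i) ^ (2 * \<alpha> $ i + \<beta> $ i)))"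
        by (rule ext) (simp only: Pair monomial)
      then show ?thesis
        by (auto intro!: measurable_sphere_measure)
    qed
  qed
  have sum: "((\<lambda>p. ?f p t) has_sum ?S t) UNIV" for t
    using has_sum_exp_weight[of "\<chi> i. x $ i * (t $ i)\<^sup>2" "\<chi> i. y $ i * t $ i"]
    by (simp add: case_prod_unfold)
  have summable: "?B summable_on UNIV"
    by (rule has_sum_imp_summable[OF has_sum_exp_weight])
  have int_S: "integrable ?M ?S"
  proof (rule integrable_const_bound)
    have "\<bar>?S t\<bar> \<le> infsum ?B UNIV" if "t \<in> space ?M" for t
    proof -
      have "?S t \<le> infsum ?B UNIV"
        using bound[OF that] by (intro has_sum_mono[OF sum has_sum_infsum[OF summable]]) (rule abs_le_D1)
      then show ?thesis by simp
    qed
    then show "AE t in ?M. norm (?S t) \<le> infsum ?B UNIV" by auto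
    show "?S \<in> borel_measurable ?M"
      by (rule measurable_sphere_measure) measurable
  qed
  have "((\<lambda>p. \<integral>t. ?f p t \<partial>?M) has_sum (\<integral>t. ?S t \<partial>?M)) UNIV"
    by (rule has_sum_integral_Weierstrass[OF fin int int_S bound summable sum])
  moreover have "(\<lambda>p. \<integral>t. ?f p t \<partial>?M) = (\<lambda>(\<alpha>, \<beta>). exp_weight x \<alpha> * exp_weight y \<beta> *
      (\<integral>t. (\<Prod>i\<in>UNIV. (t $ i) ^ (2 * \<alpha> $ i + \<beta> $ i)) \<partial>?M))"
    unfolding fun_eq_iff split_paired_All monomial by simp
  ultimately show ?thesis
    by (simp add: Z_tilde_def)
qed

text \<open>Moments with an odd exponent vanish, so only the pairs (\<alpha>, 2 \<beta>) contribute.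
  Reindexing along \<open>?dbl\<close> and inserting the even moments produces the coefficients of
  \<open>Z_term\<close>.\<close>

lemma has_sum_Z_tilde:
  fixes x y :: "real ^ 'n"
  assumes "1 \<le> d" and "CARD('n) = d + 1" and "0 < r"
  shows "((\<lambda>(\<alpha>, \<beta>). sphere_area TYPE('n) * Z_term d x y r \<alpha> \<beta>) has_sum Z_tilde x y r) UNIV"
proof -
  let ?M = "sphere_measure r :: (real ^ 'n) measure"
  let ?h = "\<lambda>(\<alpha> :: nat ^ 'n, \<beta> :: nat ^ 'n). exp_weight x \<alpha> * exp_weight y \<beta> *
      (\<integral>t. (\<Prod>i\<in>UNIV. (t $ i) ^ (2 * \<alpha> $ i + \<beta> $ i)) \<partial>?M)"
  let ?dbl = "\<lambda>(\<alpha> :: nat ^ 'n, \<beta> :: nat ^ 'n). (\<alpha>, 2 *s \<beta>)"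
  have odd: "?h p = 0" if "p \<notin> range ?dbl" for p
  proof -
    obtain \<alpha> \<beta> where p: "p = (\<alpha>, \<beta>)" by fastforce
    have "\<exists>i. odd (\<beta> $ i)"
    proof (rule ccontr)
      assume "\<nexists>i. odd (\<beta> $ i)"
      then have "p = ?dbl (\<alpha>, \<chi> i. \<beta> $ i div 2)" by (simp add: p vec_eq_iff)
      then show False using that by blast
    qed
    then obtain i where "odd (2 * \<alpha> $ i + \<beta> $ i)" by auto
    then show ?thesis
      using sphere_moment_odd[of "\<lambda>i. 2 * \<alpha> $ i + \<beta> $ i" i] by (simp add: p integral_sphere_monomial[OF assms(2,3)])
  qed
  have even: "?h (?dbl (\<alpha>, \<beta>)) = sphere_area TYPE('n) * Z_term d x y r \<alpha> \<beta>" for \<alpha> \<beta>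
  proof -
    have "2 * \<alpha> $ i + (2 *s \<beta>) $ i = 2 * (\<alpha> $ i + \<beta> $ i)" for i by simp
    moreover have "(\<Sum>i\<in>UNIV. 2 * (\<alpha> $ i + \<beta> $ i)) = 2 * mi_abs (\<alpha> + \<beta>)"
      by (simp add: mi_abs_def sum_distrib_left)
    moreover have "(\<Sum>i\<in>UNIV. \<alpha> $ i + \<beta> $ i) = mi_abs (\<alpha> + \<beta>)"
      by (simp add: mi_abs_def)
    ultimately show ?thesis
      unfolding Z_term_eq prod.case
      by (simp only: integral_sphere_monomial[OF assms(2,3)] sphere_moment_even[OF assms(2,1)] mult_ac)
  qed
  have inj: "inj ?dbl" by (auto simp: inj_on_def vec_eq_iff)
  have "(?h has_sum Z_tilde x y r) (range ?dbl)"
    by (rule has_sum_cong_neutral[THEN iffD1, OF _ _ _ has_sum_Z_tilde_all[OF assms(3), of x y]]) (use odd in auto)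
  then have "(?h \<circ> ?dbl has_sum Z_tilde x y r) UNIV"
    unfolding has_sum_reindex[OF inj] .
  moreover have "?h \<circ> ?dbl = (\<lambda>(\<alpha>, \<beta>). sphere_area TYPE('n) * Z_term d x y r \<alpha> \<beta>)"
    unfolding fun_eq_iff split_paired_All o_apply even by simp
  ultimately show ?thesis by simp
qed

text \<open>The Gaussian identity with all exponents 0 writes a positive number as the area times a
  positive moment.\<close>

lemma sphere_area_pos: "0 < sphere_area TYPE('n::finite)"
proof -
  have "0 < half_gaussian_moment (CARD('n) - 1)" by (rule half_gaussian_moment_pos)
  moreover have "sphere_area TYPE('n) * half_gaussian_moment (CARD('n) - 1) = sqrt pi ^ CARD('n)"
    using monomial_sphere_moment_gaussian[of "\<lambda>i :: 'n. 0"] by (simp add: sphere_area_def)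
  ultimately show ?thesis
    by (metis zero_less_mult_pos2 zero_less_power pi_gt_zero real_sqrt_gt_zero)
qed

theorem theorem2:
  fixes x y :: "real ^ 'n" and r :: real and d :: nat
  assumes "d \<ge> 1" and "CARD('n) = d + 1" and "r > 0"
  shows "((\<lambda>(\<alpha>, \<beta>). Z_term d x y r \<alpha> \<beta>) summable_on UNIV \<and>
      Z_tilde x y r = sphere_area TYPE('n) * (\<Sum>\<^sub>\<infinity>(\<alpha>, \<beta>)\<in>UNIV. Z_term d x y r \<alpha> \<beta>)) \<and>
    (\<forall>\<^sub>F N in sequentially.
      \<bar>sphere_area TYPE('n) *
        (\<Sum>\<^sub>\<infinity>(\<alpha>, \<beta>)\<in>{(\<alpha>, \<beta>). mi_abs (\<alpha> + \<beta>) \<ge> N}. Z_term d x y r \<alpha> \<beta>)\<bar>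
      \<le> sphere_area TYPE('n) * (r ^ d / fact N) *
        (r\<^sup>2 * (\<Sum>i\<in>UNIV. \<bar>x $ i\<bar> + \<bar>y $ i\<bar>\<^sup>2)) ^ N *
        ((real N + 1) / (real N + 1 - r\<^sup>2 * (\<Sum>i\<in>UNIV. \<bar>x $ i\<bar> + \<bar>y $ i\<bar>\<^sup>2))))"
proof (intro conjI)
  have pos: "0 < sphere_area TYPE('n)" by (rule sphere_area_pos)
  have "((\<lambda>p. sphere_area TYPE('n) * (case p of (\<alpha>, \<beta>) \<Rightarrow> Z_term d x y r \<alpha> \<beta>)) has_sum Z_tilde x y r) UNIV"
    using has_sum_Z_tilde[OF assms, of x y] by (simp add: case_prod_unfold)
  \<comment> \<open>Dividing by the area yields summability of the terms \<open>Z_term\<close>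
    themselves.\<close>
  from has_sum_cmult_right[OF this, of "1 / sphere_area TYPE('n)"]
  have sum: "((\<lambda>(\<alpha>, \<beta>). Z_term d x y r \<alpha> \<beta>) has_sum (Z_tilde x y r / sphere_area TYPE('n))) UNIV"
    using pos by simp
  then show "(\<lambda>(\<alpha>, \<beta>). Z_term d x y r \<alpha> \<beta>) summable_on UNIV"
    by (rule has_sum_imp_summable)
  show "Z_tilde x y r = sphere_area TYPE('n) * (\<Sum>\<^sub>\<infinity>(\<alpha>, \<beta>)\<in>UNIV. Z_term d x y r \<alpha> \<beta>)"
    using infsumI[OF sum] pos by simp
  let ?A = "r\<^sup>2 * (\<Sum>i\<in>UNIV. \<bar>x $ i\<bar> + \<bar>y $ i\<bar>\<^sup>2)"
  \<comment> \<open>Here "sufficiently large" becomes explicit: the bound holds as soon as its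
    denominator N + 1 - \<open>?A\<close> is positive.\<close>
  have "\<forall>\<^sub>F N in sequentially. ?A < real N + 1"
    using eventually_gt_at_top[of "nat \<lceil>?A\<rceil>"] by eventually_elim linarith
  then show "\<forall>\<^sub>F N in sequentially.
      \<bar>sphere_area TYPE('n) *
        (\<Sum>\<^sub>\<infinity>(\<alpha>, \<beta>)\<in>{(\<alpha>, \<beta>). mi_abs (\<alpha> + \<beta>) \<ge> N}. Z_term d x y r \<alpha> \<beta>)\<bar>
      \<le> sphere_area TYPE('n) * (r ^ d / fact N) * ?A ^ N * ((real N + 1) / (real N + 1 - ?A))"
  proof eventually_elim
    case (elim N)
    have "\<bar>sphere_area TYPE('n) *
        (\<Sum>\<^sub>\<infinity>(\<alpha>, \<beta>)\<in>{(\<alpha>, \<beta>). mi_abs (\<alpha> + \<beta>) \<ge> N}. Z_term d x y r \<alpha> \<beta>)\<bar> =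
      sphere_area TYPE('n) *
        \<bar>\<Sum>\<^sub>\<infinity>(\<alpha>, \<beta>)\<in>{(\<alpha>, \<beta>). mi_abs (\<alpha> + \<beta>) \<ge> N}. Z_term d x y r \<alpha> \<beta>\<bar>"
      using pos by (simp only: abs_mult abs_of_pos)
    also have "\<dots> \<le> sphere_area TYPE('n) * (r ^ d * (?A ^ N / fact N * ((real N + 1) / (real N + 1 - ?A))))"
      using pos Z_tail_le[OF assms(3) elim] by (intro mult_left_mono) auto
    finally show ?case by (simp only: divide_inverse mult_ac)
  qed
qed

end
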